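(* Let $\mathcal Q=\mathrm{LP}_l(A,A^* )$ be a symmetric canonical lifted-product code on $n$ physical qubits with canonical logical basis $\{(\bar Z_{i,j,m},\bar X_{i,j,m})\}$ (chosen with $G_B^{*0}=G_A^0$). Then the following depth-1 circuits (up to qubit permutations) implement logical gates of $\mathcal Q$, i.e. preserve the stabilizer group, with the stated actions on logical operators (modulo stabilizers): (i) The physical permutation $\sigma_t:q_{L/R}(i,j,m)\mapsto q_{L/R}(i,j,(m+t)\bmod l)$ induces $\bar Z_{i,j,m}\mapsto\bar Z_{i,j,(m+t)\bmod l}$ and $\bar X_{i,j,m}\mapsto\bar X_{i,j,(m+t)\bmod l}$. (This part holds for every canonical $\mathrm{LP}_l(A,B)$, not only $B=A^*$.) (ii) Let $\tau:q_{L/R}(i,j,m)\mapsto q_{L/R}(j,i,m)$. The circuit $\tau\circ H^{\otimes n}$ (a Hadamard on every qubit followed by the permutation $\tau$) induces $\bar Z_{i,j,m}\mapsto\bar X_{j,i,m}$ and $\bar X_{i,j,m}\mapsto\bar Z_{j,i,m}$. (iii) Let $D_L=\{q_L(i,i,m)\}_{i,m}$ and $D_R=\{q_R(i,i,m)\}_{i,m}$, and fix any total order $<$ of the physical qubits. The circuit $$\bigotimes_{q\in D_L}S_q\cdot\bigotimes_{q\in D_R}S_q^\dagger\cdot\bigotimes_{q<\tau(q)}CZ_{q,\tau(q)}$$ induces $\bar Z_{i,j,m}\mapsto\bar Z_{i,j,m}$ and $\bar X_{i,j,m}\mapsto\bar X_{i,j,m}\bar Z_{j,i,m}$ for $i\ne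 j$ (a logical $CZ$ between the paired logical qubits), while for $i=j$, $\bar X_{i,i,m}\mapsto \mathrm i\,\bar X_{i,i,m}\bar Z_{i,i,m}=\bar Y_{i,i,m}$ (a logical $S$ gate).
   Context: $R=\mathbb F_2[x]/(x^l+1)$; $\bar f(x)=f(x^{-1})$ on $R$, $A^*=\bar A^T$. For $A\in R^{m_A\times n_A}$, $B\in R^{m_B\times n_B}$, $\mathrm{LP}_l(A,B)$ is the CSS code with physical qubits indexed by the binarization (coefficients) of $R^{n_A}\otimes_R R^{m_B}\oplus R^{m_A}\otimes_R R^{n_B}$, with $X$-checks given by the binarization of $H_X=(A\otimes I_{m_B},\ I_{m_A}\otimes B)$ and $Z$-checks by that of $H_Z=(I_{n_A}\otimes B^*,\ A^*\otimes I_{n_B})$. Qubit $q_L(i,j,m)$ is the coefficient of $x^m$ at entry $(i,j)$ of the left block ($n_A\times m_B$); $q_R(i,j,m)$ likewise for the right block ($m_A\times n_B$). For $B=A^*$ both blocks are square arrays, so transposing $(i,j)$ makes sense. Canonical basis: $r_A=n_A-m_A$, $r_B^*=m_B-n_B$. The code is canonical if, after permuting coordinates of $R^{n_A}$ and $R^{m_B}$ (assumed done; for $B=A^*$ the same permutation), there are $G_A^0\in R^{r_A\times m_A}$, $G_B^{*0}\in R^{r_B^*\times n_B}$ such that, with $u^{(i)}$, $e^{(i)}$ the $i$-th rows of $(I_{r_A},G_A^0)$, $(I_{r_A},0)$, and $f^{(j)}$, $v^{(j)}$ the $j$-th rows of $(I_{r_B^*},0)$, $(I_{r_B^*},G_B^{*0})$,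 the left-block vectors $\mathrm{supp}\,\bar Z_{i,j,m}=x^mu^{(i)}\otimes_R f^{(j)}$ and $\mathrm{supp}\,\bar X_{i,j,m}=x^me^{(i)}\otimes_R v^{(j)}$ ($0\le i<r_A$, $0\le j<r_B^*$, $0\le m<l$) are members of a $Z$-type, resp. $X$-type, logical basis. $\bar Z_{i,j,m}$ (resp. $\bar X_{i,j,m}$) is the product of Pauli $Z$ (resp. $X$) over that support. *)

theory Defs
  imports
    "HOL-Library.Cardinality"
    "HOL-Library.Z2"
    "HOL-Computational_Algebra.Polynomial"
    "HOL-Algebra.Generated_Groups"
    "Jordan_Normal_Form.Matrix"
begin

section \<open>The ring \<open>\<bbbF>\<^sub>2[x]/(x\<^sup>l + 1)\<close>\<close>

text \<open>The lift size \<open>l \<ge> 1\<close> is the cardinality of the finite index type \<open>'l\<close>.\<close>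

definition lring_modulus :: "'l::finite itself \<Rightarrow> bit poly" where
  "lring_modulus _ = monom 1 CARD('l) + 1"

definition lring_rel :: "'l::finite itself \<Rightarrow> bit poly \<Rightarrow> bit poly \<Rightarrow> bool" where
  "lring_rel L p q \<longleftrightarrow> lring_modulus L dvd p - q"

lemma equivp_lring_rel: "equivp (lring_rel L)"
proof (rule equivpI)
  show "reflp (lring_rel L)"
    by (simp add: reflp_def lring_rel_def)
  show "symp (lring_rel L)"
    by (metis (no_types, lifting) sympI lring_rel_def dvd_minus_iff minus_diff_eq)
  show "transp (lring_rel L)"
  proof (rule transpI)
    fix p q r assume "lring_rel L p q" "lring_rel L q r"
    then have "lring_modulus L dvd (p - q) + (q - r)"
      unfolding lring_rel_def by (rule dvd_add)
    then show "lring_rel L p r" by (simp add: lring_rel_def)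
  qed
qed

quotient_type (overloaded) 'l lring = "bit poly" / "lring_rel TYPE('l::finite)"
  by (rule equivp_lring_rel)

instantiation lring :: (finite) comm_ring_1
begin

lift_definition zero_lring :: "'a lring" is 0 .
lift_definition one_lring :: "'a lring" is 1 .
lift_definition plus_lring :: "'a lring \<Rightarrow> 'a lring \<Rightarrow> 'a lring" is "(+)"
  by (simp add: lring_rel_def add_diff_add)
lift_definition uminus_lring :: "'a lring \<Rightarrow> 'a lring" is uminus
  unfolding lring_rel_def by (metis dvd_minus_iff minus_diff_minus)
lift_definition minus_lring :: "'a lring \<Rightarrow> 'a lring \<Rightarrow> 'a lring" is "(-)"
  unfolding lring_rel_def by (drule (1) dvd_diff) (simp add: algebra_simps)
lift_definition times_lring :: "'a lring \<Rightarrow> 'a lring \<Rightarrow> 'a lring" is "(*)"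
proof -
  fix p p' q q' :: "bit poly"
  assume "lring_rel TYPE('a) p p'" "lring_rel TYPE('a) q q'"
  then have "lring_modulus TYPE('a) dvd (p - p') * q + p' * (q - q')"
    unfolding lring_rel_def by (intro dvd_add dvd_mult dvd_mult2)
  then show "lring_rel TYPE('a) (p * q) (p' * q')"
    by (simp add: lring_rel_def algebra_simps)
qed

instance
proof
  show "(0::'a lring) \<noteq> 1"
  proof (transfer, unfold lring_rel_def lring_modulus_def)
    have "degree (monom 1 CARD('a) + 1 :: bit poly) = CARD('a)"
      by (subst degree_add_eq_left) (simp_all add: degree_monom_eq)
    then have "\<not> (monom 1 CARD('a) + 1 :: bit poly) dvd 1"
      using dvd_imp_degree_le[of "monom 1 CARD('a) + 1 :: bit poly" 1] by auto
    then show "\<not> (monom 1 CARD('a) + 1 :: bit poly) dvd 0 - 1"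
      by (simp del: uminus_bit_def)
  qed
qed (transfer; simp add: lring_rel_def algebra_simps)+

end

lift_definition lring_X :: "'l::finite lring" is "monom 1 1" .

text \<open>Coefficient of \<open>x\<^sup>k\<close> in the representative of degree less than \<open>l\<close>.\<close>

lift_definition lring_coeff :: "'l::finite lring \<Rightarrow> nat \<Rightarrow> bit"
  is "\<lambda>p k. coeff (p mod lring_modulus TYPE('l)) k"
  by (auto simp: lring_rel_def simp flip: mod_eq_dvd_iff)

lemma pcompose_monom_one: "pcompose (monom 1 n) y = (y :: bit poly) ^ n"
  by (induction n) (simp_all add: monom_Suc pcompose_pCons pcompose_1)

text \<open>\<open>f(x\<inverse>)\<close>, where \<open>x\<inverse> = x\<^bsup>l-1\<^esup>\<close> in the quotient ring.\<close>

lift_definition lring_bar :: "'l::finite lring \<Rightarrow> 'l lring"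
  is "\<lambda>p. pcompose p (monom 1 (CARD('l) - 1))"
proof -
  fix p q :: "bit poly"
  let ?m = "lring_modulus TYPE('l)" and ?y = "monom 1 (CARD('l) - 1) :: bit poly"
  have m: "?m = monom 1 CARD('l) - 1"
    by (simp add: lring_modulus_def poly_eq_iff)
  have "?m dvd monom 1 CARD('l) ^ (CARD('l) - 1) - 1"
    unfolding m power_diff_1_eq by simp
  also have "monom 1 CARD('l) ^ (CARD('l) - 1) = ?y ^ CARD('l)"
    by (simp add: monom_power mult.commute)
  also have "?y ^ CARD('l) - 1 = pcompose ?m ?y"
    by (simp add: m pcompose_diff pcompose_monom_one pcompose_1)
  finally have y: "?m dvd pcompose ?m ?y" .
  assume "lring_rel TYPE('l) p q"
  then obtain k where "p - q = ?m * k"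
    by (auto simp: lring_rel_def)
  then have "pcompose p ?y - pcompose q ?y = pcompose ?m ?y * pcompose k ?y"
    by (metis pcompose_diff pcompose_mult)
  then show "lring_rel TYPE('l) (pcompose p ?y) (pcompose q ?y)"
    using y by (simp add: lring_rel_def)
qed

lemma lring_X_inverse: "lring_X * lring_X ^ (CARD('l) - 1) = (1 :: 'l::finite lring)"
proof -
  have pow: "lring_X ^ n = (abs_lring (monom 1 n) :: 'l lring)" for n
  proof (induction n)
    case 0
    then show ?case by (simp add: one_lring_def)
  next
    case (Suc n)
    then show ?case
      by (simp add: lring_X_def times_lring.abs_eq mult_monom)
  qed
  have "(monom 1 CARD('l) - 1 :: bit poly) = monom 1 CARD('l) + 1"
    by (simp add: poly_eq_iff)
  then have "lring_rel TYPE('l) (monom 1 CARD('l)) 1"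
    by (metis dvd_refl lring_modulus_def lring_rel_def)
  then have "lring_X ^ CARD('l) = (1 :: 'l lring)"
    by (simp add: pow one_lring_def lring.abs_eq_iff)
  then show ?thesis
    by (simp flip: power_Suc)
qed


section \<open>Lifted-product codes\<close>

definition star_mat :: "'l::finite lring mat \<Rightarrow> 'l lring mat" where
  "star_mat A = map_mat lring_bar (transpose_mat A)"

definition kron_entry ::
    "'l::finite lring mat \<Rightarrow> 'l lring mat \<Rightarrow> nat \<times> nat \<Rightarrow> nat \<times> nat \<Rightarrow> 'l lring" where
  "kron_entry A B = (\<lambda>(r, r') (c, c'). A $$ (r, c) * B $$ (r', c'))"

text \<open>
  \<open>LBlock i j\<close> and \<open>RBlock i j\<close> are the positions \<open>(i, j)\<close> of
  \<open>R\<^bsup>n_A\<^esup> \<otimes> R\<^bsup>m_B\<^esup>\<close> and \<open>R\<^bsup>m_A\<^esup> \<otimes> R\<^bsup>n_B\<^esup>\<close>; a qubit \<open>(c, m)\<close> is the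
  coefficient of \<open>x\<^sup>m\<close> at position \<open>c\<close>.
\<close>

datatype position = LBlock nat nat | RBlock nat nat

type_synonym qubit = "position \<times> nat"

abbreviation q_L :: "nat \<Rightarrow> nat \<Rightarrow> nat \<Rightarrow> qubit" where
  "q_L i j m \<equiv> (LBlock i j, m)"

abbreviation q_R :: "nat \<Rightarrow> nat \<Rightarrow> nat \<Rightarrow> qubit" where
  "q_R i j m \<equiv> (RBlock i j, m)"

definition qubits :: "'l::finite lring mat \<Rightarrow> 'l lring mat \<Rightarrow> qubit set" where
  "qubits A B =
     {q_L i j m | i j m. i < dim_col A \<and> j < dim_row B \<and> m < CARD('l)} \<union>
     {q_R i j m | i j m. i < dim_row A \<and> j < dim_col B \<and> m < CARD('l)}"

definition H_X ::
    "'l::finite lring mat \<Rightarrow> 'l lring mat \<Rightarrow> nat \<times> nat \<Rightarrow> position \<Rightarrow> 'l lring" where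
  "H_X A B r c =
     (case c of
        LBlock i j \<Rightarrow> kron_entry A (1\<^sub>m (dim_row B)) r (i, j)
      | RBlock i j \<Rightarrow> kron_entry (1\<^sub>m (dim_row A)) B r (i, j))"

definition H_Z ::
    "'l::finite lring mat \<Rightarrow> 'l lring mat \<Rightarrow> nat \<times> nat \<Rightarrow> position \<Rightarrow> 'l lring" where
  "H_Z A B r c =
     (case c of
        LBlock i j \<Rightarrow> kron_entry (1\<^sub>m (dim_col A)) (star_mat B) r (i, j)
      | RBlock i j \<Rightarrow> kron_entry (star_mat A) (1\<^sub>m (dim_col B)) r (i, j))"

text \<open>
  Binarization replaces a vector by its coefficients and a matrix entry \<open>a\<close> by the
  \<open>l \<times> l\<close> matrix of multiplication by \<open>a\<close> in the basis \<open>1, x, \<dots>, x\<^bsup>l-1\<^esup>\<close>, so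
  that the binarization of \<open>H v\<close> is the product of those of \<open>H\<close> and \<open>v\<close>.
\<close>

definition bin_vec :: "('c \<Rightarrow> 'l::finite lring) \<Rightarrow> 'c \<times> nat \<Rightarrow> bit" where
  "bin_vec v = (\<lambda>(c, m). lring_coeff (v c) m)"

definition bin_mat ::
    "('r \<Rightarrow> 'c \<Rightarrow> 'l::finite lring) \<Rightarrow> 'r \<times> nat \<Rightarrow> 'c \<times> nat \<Rightarrow> bit" where
  "bin_mat H = (\<lambda>(r, k) (c, m). lring_coeff (H r c * lring_X ^ m) k)"

text \<open>
  Vectors of \<open>\<bbbF>\<^sub>2\<^sup>n\<close> are functions on qubits that vanish off the finite set \<open>Q\<close> of
  physical qubits.
\<close>

definition restrict_vec :: "qubit set \<Rightarrow> (qubit \<Rightarrow> bit) \<Rightarrow> qubit \<Rightarrow> bit" where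
  "restrict_vec Q v = (\<lambda>q. if q \<in> Q then v q else 0)"

definition supp :: "(qubit \<Rightarrow> bit) \<Rightarrow> qubit set" where
  "supp v = {q. v q = 1}"

definition X_checks :: "'l::finite lring mat \<Rightarrow> 'l lring mat \<Rightarrow> (qubit \<Rightarrow> bit) set" where
  "X_checks A B =
     {restrict_vec (qubits A B) (bin_mat (H_X A B) ((r, r'), k)) | r r' k.
        r < dim_row A \<and> r' < dim_row B \<and> k < CARD('l)}"

definition Z_checks :: "'l::finite lring mat \<Rightarrow> 'l lring mat \<Rightarrow> (qubit \<Rightarrow> bit) set" where
  "Z_checks A B =
     {restrict_vec (qubits A B) (bin_mat (H_Z A B) ((r, r'), k)) | r r' k.
        r < dim_col A \<and> r' < dim_col B \<and> k < CARD('l)}"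

definition check_kernel :: "qubit set \<Rightarrow> (qubit \<Rightarrow> bit) set \<Rightarrow> (qubit \<Rightarrow> bit) set" where
  "check_kernel Q C = {v. supp v \<subseteq> Q \<and> (\<forall>h\<in>C. (\<Sum>q\<in>Q. h q * v q) = 0)}"

definition row_space :: "(qubit \<Rightarrow> bit) set \<Rightarrow> (qubit \<Rightarrow> bit) set" where
  "row_space C = {(\<lambda>q. \<Sum>h\<in>T. h q) | T. T \<subseteq> C}"

text \<open>
  The classes of the elements of \<open>\<B>\<close> are pairwise distinct and form a basis of the
  \<open>\<bbbF>\<^sub>2\<close>-space \<open>V/W\<close>: every class is the sum of exactly one subset of \<open>\<B>\<close>.
\<close>

definition basis_modulo ::
    "(qubit \<Rightarrow> bit) set \<Rightarrow> (qubit \<Rightarrow> bit) set \<Rightarrow> (qubit \<Rightarrow> bit) set \<Rightarrow> bool" where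
  "basis_modulo V W \<B> \<longleftrightarrow>
     \<B> \<subseteq> V \<and> (\<forall>v\<in>V. \<exists>!T. T \<subseteq> \<B> \<and> (\<lambda>q. v q - (\<Sum>b\<in>T. b q)) \<in> W)"

definition Z_logical_basis ::
    "'l::finite lring mat \<Rightarrow> 'l lring mat \<Rightarrow> (qubit \<Rightarrow> bit) set \<Rightarrow> bool" where
  "Z_logical_basis A B =
     basis_modulo (check_kernel (qubits A B) (X_checks A B)) (row_space (Z_checks A B))"

definition X_logical_basis ::
    "'l::finite lring mat \<Rightarrow> 'l lring mat \<Rightarrow> (qubit \<Rightarrow> bit) set \<Rightarrow> bool" where
  "X_logical_basis A B =
     basis_modulo (check_kernel (qubits A B) (Z_checks A B)) (row_space (X_checks A B))"


section \<open>The canonical basis\<close>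

text \<open>Subtraction is truncated; \<open>canonical_code_basis\<close> excludes the truncating case.\<close>

definition r_A :: "'l::finite lring mat \<Rightarrow> nat" where
  "r_A A = dim_col A - dim_row A"

definition r_B :: "'l::finite lring mat \<Rightarrow> nat" where
  "r_B B = dim_row B - dim_col B"

definition append_id :: "nat \<Rightarrow> 'l::finite lring mat \<Rightarrow> 'l lring mat" where
  "append_id r G = four_block_mat (1\<^sub>m r) G (0\<^sub>m 0 r) (0\<^sub>m 0 (dim_col G))"

definition left_tensor :: "'l::finite lring vec \<Rightarrow> 'l lring vec \<Rightarrow> position \<Rightarrow> 'l lring" where
  "left_tensor u f c = (case c of LBlock a b \<Rightarrow> u $ a * f $ b | RBlock a b \<Rightarrow> 0)"

definition canonical_Z_vec ::
    "'l::finite lring mat \<Rightarrow> 'l lring mat \<Rightarrow> 'l lring mat \<Rightarrow> nat \<Rightarrow> nat \<Rightarrow> nat \<Rightarrow> qubit \<Rightarrow> bit" where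
  "canonical_Z_vec A B GA i j m =
     (let u = row (append_id (r_A A) GA) i;
          f = row (append_id (r_B B) (0\<^sub>m (r_B B) (dim_col B))) j
      in restrict_vec (qubits A B) (bin_vec (\<lambda>c. lring_X ^ m * left_tensor u f c)))"

definition canonical_X_vec ::
    "'l::finite lring mat \<Rightarrow> 'l lring mat \<Rightarrow> 'l lring mat \<Rightarrow> nat \<Rightarrow> nat \<Rightarrow> nat \<Rightarrow> qubit \<Rightarrow> bit" where
  "canonical_X_vec A B GB i j m =
     (let e = row (append_id (r_A A) (0\<^sub>m (r_A A) (dim_row A))) i;
          v = row (append_id (r_B B) GB) j
      in restrict_vec (qubits A B) (bin_vec (\<lambda>c. lring_X ^ m * left_tensor e v c)))"

definition canonical_code_basis ::
    "'l::finite lring mat \<Rightarrow> 'l lring mat \<Rightarrow> 'l lring mat \<Rightarrow> 'l lring mat \<Rightarrow> bool" where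
  "canonical_code_basis A B GA GB \<longleftrightarrow>
     dim_row A \<le> dim_col A \<and> dim_col B \<le> dim_row B \<and>
     GA \<in> carrier_mat (r_A A) (dim_row A) \<and>
     GB \<in> carrier_mat (r_B B) (dim_col B) \<and>
     (\<exists>\<B>. Z_logical_basis A B \<B> \<and>
        {canonical_Z_vec A B GA i j m | i j m. i < r_A A \<and> j < r_B B \<and> m < CARD('l)} \<subseteq> \<B>) \<and>
     (\<exists>\<B>. X_logical_basis A B \<B> \<and>
        {canonical_X_vec A B GB i j m | i j m. i < r_A A \<and> j < r_B B \<and> m < CARD('l)} \<subseteq> \<B>)"


section \<open>Operators on \<open>(\<complex>\<^sup>2)\<^bsup>\<otimes>Q\<^esup>\<close>\<close>

text \<open>
  The computational basis vector labelled by \<open>S \<subseteq> Q\<close> has exactly the qubits in \<open>S\<close> in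
  state \<open>1\<close>. An operator is its matrix; entries with a label outside \<open>Pow Q\<close> are \<open>0\<close>,
  so that operators are equal iff their matrices are.
\<close>

type_synonym 'q oper = "'q set \<Rightarrow> 'q set \<Rightarrow> complex"

definition op_one :: "'q set \<Rightarrow> 'q oper" where
  "op_one Q = (\<lambda>S T. if S \<subseteq> Q \<and> S = T then 1 else 0)"

definition op_mult :: "'q set \<Rightarrow> 'q oper \<Rightarrow> 'q oper \<Rightarrow> 'q oper" where
  "op_mult Q M N = (\<lambda>S T. \<Sum>U\<in>Pow Q. M S U * N U T)"

definition op_scale :: "complex \<Rightarrow> 'q oper \<Rightarrow> 'q oper" where
  "op_scale c M = (\<lambda>S T. c * M S T)"

definition op_adjoint :: "'q oper \<Rightarrow> 'q oper" where
  "op_adjoint M = (\<lambda>S T. cnj (M T S))"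

definition op_conj :: "'q set \<Rightarrow> 'q oper \<Rightarrow> 'q oper \<Rightarrow> 'q oper" where
  "op_conj Q U M = op_mult Q U (op_mult Q M (op_adjoint U))"

definition unitary_group :: "'q set \<Rightarrow> 'q oper monoid" where
  "unitary_group Q =
     \<lparr>carrier = {M. (\<forall>S T. \<not> (S \<subseteq> Q \<and> T \<subseteq> Q) \<longrightarrow> M S T = 0) \<and>
                   op_mult Q M (op_adjoint M) = op_one Q \<and>
                   op_mult Q (op_adjoint M) M = op_one Q},
      mult = op_mult Q, one = op_one Q\<rparr>"

text \<open>A one-qubit operator \<open>g\<close> is its \<open>2 \<times> 2\<close> matrix, \<open>False\<close> and \<open>True\<close> standing for \<open>0\<close> and \<open>1\<close>.\<close>

type_synonym oper1 = "bool \<Rightarrow> bool \<Rightarrow> complex"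

definition id1 :: oper1 where "id1 a b = (if a = b then 1 else 0)"
definition pauli_x1 :: oper1 where "pauli_x1 a b = (if a = b then 0 else 1)"
definition pauli_z1 :: oper1 where "pauli_z1 a b = (if a = b then if a then - 1 else 1 else 0)"
definition hadamard1 :: oper1 where "hadamard1 a b = (if a \<and> b then - 1 else 1) / sqrt 2"
definition phase1 :: oper1 where "phase1 a b = (if a = b then if a then \<i> else 1 else 0)"
definition phase_dag1 :: oper1 where "phase_dag1 a b = (if a = b then if a then - \<i> else 1 else 0)"

definition tensor_op :: "'q set \<Rightarrow> ('q \<Rightarrow> oper1) \<Rightarrow> 'q oper" where
  "tensor_op Q g =
     (\<lambda>S T. if S \<subseteq> Q \<and> T \<subseteq> Q then \<Prod>q\<in>Q. g q (q \<in> S) (q \<in> T) else 0)"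

definition pauli_X :: "'q set \<Rightarrow> 'q set \<Rightarrow> 'q oper" where
  "pauli_X Q s = tensor_op Q (\<lambda>q. if q \<in> s then pauli_x1 else id1)"

definition pauli_Z :: "'q set \<Rightarrow> 'q set \<Rightarrow> 'q oper" where
  "pauli_Z Q s = tensor_op Q (\<lambda>q. if q \<in> s then pauli_z1 else id1)"

text \<open>The permutation \<open>\<pi>\<close> moves the state of qubit \<open>q\<close> to qubit \<open>\<pi> q\<close>.\<close>

definition perm_op :: "'q set \<Rightarrow> ('q \<Rightarrow> 'q) \<Rightarrow> 'q oper" where
  "perm_op Q \<pi> = (\<lambda>S T. if T \<subseteq> Q \<and> S = \<pi> ` T then 1 else 0)"

datatype 'q gate = Hadamard 'q | Phase 'q | PhaseDag 'q | CZ 'q 'q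

fun gate_qubits :: "'q gate \<Rightarrow> 'q set" where
  "gate_qubits (Hadamard q) = {q}"
| "gate_qubits (Phase q) = {q}"
| "gate_qubits (PhaseDag q) = {q}"
| "gate_qubits (CZ p q) = {p, q}"

fun gate_op :: "'q set \<Rightarrow> 'q gate \<Rightarrow> 'q oper" where
  "gate_op Q (Hadamard q) = tensor_op Q ((\<lambda>_. id1)(q := hadamard1))"
| "gate_op Q (Phase q) = tensor_op Q ((\<lambda>_. id1)(q := phase1))"
| "gate_op Q (PhaseDag q) = tensor_op Q ((\<lambda>_. id1)(q := phase_dag1))"
| "gate_op Q (CZ p q) =
     (\<lambda>S T. if S \<subseteq> Q \<and> S = T then if p \<in> S \<and> q \<in> S then - 1 else 1 else 0)"

text \<open>Gates are listed in the order in which they are applied.\<close>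

fun circuit_op :: "'q set \<Rightarrow> 'q gate list \<Rightarrow> 'q oper" where
  "circuit_op Q [] = op_one Q"
| "circuit_op Q (g # gs) = op_mult Q (circuit_op Q gs) (gate_op Q g)"

definition depth_one :: "'q gate list \<Rightarrow> bool" where
  "depth_one gs \<longleftrightarrow> sorted_wrt (\<lambda>g h. gate_qubits g \<inter> gate_qubits h = {}) gs"


section \<open>Stabilizers and logical operators\<close>

definition stabilizer_group :: "'l::finite lring mat \<Rightarrow> 'l lring mat \<Rightarrow> qubit oper set" where
  "stabilizer_group A B =
     generate (unitary_group (qubits A B))
       ((\<lambda>h. pauli_X (qubits A B) (supp h)) ` X_checks A B \<union>
        (\<lambda>h. pauli_Z (qubits A B) (supp h)) ` Z_checks A B)"

definition preserves_stabilizers ::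
    "'l::finite lring mat \<Rightarrow> 'l lring mat \<Rightarrow> qubit oper \<Rightarrow> bool" where
  "preserves_stabilizers A B U \<longleftrightarrow>
     op_conj (qubits A B) U ` stabilizer_group A B = stabilizer_group A B"

definition induces ::
    "'l::finite lring mat \<Rightarrow> 'l lring mat \<Rightarrow> qubit oper \<Rightarrow> qubit oper \<Rightarrow> qubit oper \<Rightarrow> bool" where
  "induces A B U P P' \<longleftrightarrow>
     (\<exists>s\<in>stabilizer_group A B. op_conj (qubits A B) U P = op_mult (qubits A B) P' s)"

definition logical_Z ::
    "'l::finite lring mat \<Rightarrow> 'l lring mat \<Rightarrow> 'l lring mat \<Rightarrow> nat \<Rightarrow> nat \<Rightarrow> nat \<Rightarrow> qubit oper" where
  "logical_Z A B GA i j m = pauli_Z (qubits A B) (supp (canonical_Z_vec A B GA i j m))"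

definition logical_X ::
    "'l::finite lring mat \<Rightarrow> 'l lring mat \<Rightarrow> 'l lring mat \<Rightarrow> nat \<Rightarrow> nat \<Rightarrow> nat \<Rightarrow> qubit oper" where
  "logical_X A B GB i j m = pauli_X (qubits A B) (supp (canonical_X_vec A B GB i j m))"

definition logical_Y ::
    "'l::finite lring mat \<Rightarrow> 'l lring mat \<Rightarrow> 'l lring mat \<Rightarrow> 'l lring mat \<Rightarrow>
       nat \<Rightarrow> nat \<Rightarrow> nat \<Rightarrow> qubit oper" where
  "logical_Y A B GA GB i j m =
     op_scale \<i> (op_mult (qubits A B) (logical_X A B GB i j m) (logical_Z A B GA i j m))"

definition shift_qubit :: "nat \<Rightarrow> nat \<Rightarrow> qubit \<Rightarrow> qubit" where
  "shift_qubit l t = (\<lambda>(c, m). (c, (m + t) mod l))"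

fun transpose_qubit :: "qubit \<Rightarrow> qubit" where
  "transpose_qubit (LBlock i j, m) = (LBlock j i, m)"
| "transpose_qubit (RBlock i j, m) = (RBlock j i, m)"

definition diagonal_L :: "'l::finite lring mat \<Rightarrow> 'l lring mat \<Rightarrow> qubit set" where
  "diagonal_L A B = {q_L i i m | i m. q_L i i m \<in> qubits A B}"

definition diagonal_R :: "'l::finite lring mat \<Rightarrow> 'l lring mat \<Rightarrow> qubit set" where
  "diagonal_R A B = {q_R i i m | i m. q_R i i m \<in> qubits A B}"

end

theory Submission
  imports Defs
begin

text \<open>
  A permutation of the qubits conjugates \<open>X(s)\<close> and \<open>Z(s)\<close> to \<open>X(\<pi> s)\<close> and \<open>Z(\<pi> s)\<close>, and \<open>H\<close> on every
  qubit exchanges \<open>X(s)\<close> and \<open>Z(s)\<close>. Shifting by \<open>t\<close> multiplies checks and logical vectors by \<open>x\<^sup>t\<close>,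
  and for \<open>B = A\<^sup>*\<close> transposition exchanges the \<open>X\<close>-check \<open>(r, r', k)\<close> with the \<open>Z\<close>-check \<open>(r', r, k)\<close>
  and the supports of the logical \<open>Z\<close> at \<open>(i, j, m)\<close> and the logical \<open>X\<close> at \<open>(j, i, m)\<close>.

  The diagonal circuit fixes every \<open>Z(s)\<close>. If \<open>s\<close> contains no two distinct qubits exchanged by \<open>\<tau>\<close>, it
  sends \<open>X(s)\<close> to \<open>\<i>\<^sup>a (- \<i>)\<^sup>b X(s) Z(\<tau> s)\<close>, where \<open>a\<close> and \<open>b\<close> count the diagonal qubits of \<open>s\<close> in
  the left and right block. For an \<open>X\<close>-check \<open>a = b\<close>, and \<open>Z(\<tau> s)\<close> is a stabilizer; for the logical
  \<open>X\<close> at \<open>(i, j, m)\<close>, \<open>b = 0\<close> and \<open>a\<close> is \<open>1\<close> or \<open>0\<close> according to whether \<open>i = j\<close>. All stated images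
  therefore hold exactly, not only modulo stabilizers.
\<close>

section \<open>Cyclic coefficients\<close>

text \<open>Horner's scheme: every residue comes from a polynomial, and \<open>pCons c p\<close>
  represents \<open>c + lring_X * p\<close> with \<open>c\<close> either 0 or 1. Identities additive
  in the ring element thus reduce to their behaviour under multiplication by
  \<open>lring_X\<close>.\<close>

lemma lring_induct [case_names zero X_mult one_plus_X_mult]:
  fixes a :: "'l::finite lring"
  assumes "P 0" "\<And>a. P a \<Longrightarrow> P (lring_X * a)" "\<And>a. P a \<Longrightarrow> P (1 + lring_X * a)"
  shows "P a"
proof -
  have "P (abs_lring p)" for p
  proof (induction p)
    case 0
    show ?case using assms(1) by (simp add: zero_lring_def)
  next
    case (pCons c p)
    have "abs_lring (pCons c p) = (abs_lring [:c:] :: 'l lring) + lring_X * abs_lring p"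
      by (simp add: lring_X_def times_lring.abs_eq plus_lring.abs_eq monom_Suc monom_0)
    moreover have "abs_lring [:c:] = (0 :: 'l lring) \<or> abs_lring [:c:] = (1 :: 'l lring)"
      by (cases c) (auto simp: zero_lring_def one_lring_def one_pCons)
    ultimately show ?case using pCons.IH assms(2,3) by auto
  qed
  then show ?thesis by (metis Quotient_abs_rep[OF Quotient_lring])
qed

text \<open>Integer indices modulo l let multiplication by \<open>lring_X\<close> and
  \<open>lring_bar\<close> act as \<open>k - 1\<close> and \<open>- k\<close>, with no case split at
  the wrap-around.\<close>

definition lring_cyc :: "'l::finite lring \<Rightarrow> int \<Rightarrow> bit" where
  "lring_cyc a k = lring_coeff a (nat (k mod int CARD('l)))"

lemma lring_coeff_eq_cyc: "k < CARD('l) \<Longrightarrow> lring_coeff (a :: 'l::finite lring) k = lring_cyc a (int k)"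
  by (simp add: lring_cyc_def nat_mod_as_int[symmetric] flip: zmod_int)

lemma lring_cyc_cong:
  "k mod int CARD('l) = k' mod int CARD('l) \<Longrightarrow> lring_cyc (a :: 'l::finite lring) k = lring_cyc a k'"
  by (simp add: lring_cyc_def)

lemma lring_cyc_zero [simp]: "lring_cyc 0 k = 0"
  unfolding lring_cyc_def by transfer simp

lemma lring_cyc_add [simp]: "lring_cyc (a + b) k = lring_cyc a k + lring_cyc b k"
  unfolding lring_cyc_def by transfer (simp add: poly_mod_add_left)

lemma degree_lring_modulus: "degree (lring_modulus TYPE('l::finite)) = CARD('l)"
  unfolding lring_modulus_def by (subst degree_add_eq_left) (simp_all add: degree_monom_eq)

lemma lring_cyc_one: "lring_cyc (1 :: 'l::finite lring) k = of_bool (int CARD('l) dvd k)"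
proof -
  have "(1::bit poly) mod lring_modulus TYPE('l) = 1"
    by (rule mod_poly_less) (simp add: degree_lring_modulus)
  then have "lring_coeff (1 :: 'l lring) n = of_bool (n = 0)" for n
    by transfer (simp add: coeff_1)
  moreover have "0 \<le> k mod int CARD('l)"
    by simp
  then have "nat (k mod int CARD('l)) = 0 \<longleftrightarrow> k mod int CARD('l) = 0"
    by linarith
  ultimately show ?thesis
    by (simp add: lring_cyc_def dvd_eq_mod_eq_0)
qed

text \<open>Multiplication by \<open>lring_X\<close> puts the top coefficient at degree l; reduction
  then subtracts that multiple of the modulus, whose only other nonzero coefficient sits at degree
  0. So index 0 receives the coefficient of index l - 1.\<close>

lemma lring_coeff_X_mult:
  "k < CARD('l) \<Longrightarrow>
    lring_coeff (lring_X * a) k = lring_coeff (a :: 'l::finite lring) (if k = 0 then CARD('l) - 1 else k - 1)"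
proof (transfer fixing: k)
  fix p :: "bit poly"
  assume k: "k < CARD('l)"
  let ?m = "lring_modulus TYPE('l)"
  have m: "coeff ?m CARD('l) = 1" "coeff ?m k = of_bool (k = 0)" "?m \<noteq> 0"
    using k degree_lring_modulus[where 'l='l] by (auto simp: lring_modulus_def coeff_1)
  have "monom 1 1 * p = pCons 0 p"
    by (simp add: monom_Suc monom_0)
  then show "coeff (monom 1 1 * p mod ?m) k =
      coeff (p mod ?m) (if k = 0 then CARD('l) - 1 else k - 1)"
    using m k by (auto simp: mod_pCons degree_lring_modulus coeff_pCons split: nat.splits)
qed

lemma lring_cyc_X_mult [simp]: "lring_cyc (lring_X * a) k = lring_cyc (a :: 'l::finite lring) (k - 1)"
proof -
  let ?l = "int CARD('l)"
  have l: "?l > 0" by simp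
  have r: "0 \<le> k mod ?l" "k mod ?l < ?l" by simp_all
  have "(k - 1) mod ?l = (k mod ?l - 1) mod ?l"
    by (simp add: mod_diff_left_eq)
  also have "\<dots> = (if k mod ?l = 0 then ?l - 1 else k mod ?l - 1)"
  proof (cases "k mod ?l = 0")
    case True
    then show ?thesis using l by (simp add: zmod_minus1)
  next
    case False
    then have "1 \<le> k mod ?l" using r by linarith
    then have "(k mod ?l - 1) mod ?l = k mod ?l - 1"
      using r by (intro mod_pos_pos_trivial) linarith+
    then show ?thesis using False by simp
  qed
  finally have *: "(k - 1) mod ?l = (if k mod ?l = 0 then ?l - 1 else k mod ?l - 1)" .
  have 0: "nat (k mod ?l) = 0 \<longleftrightarrow> k mod ?l = 0"
    using r by linarith
  have "nat ((k - 1) mod ?l) =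
      (if nat (k mod ?l) = 0 then CARD('l) - 1 else nat (k mod ?l) - 1)"
    unfolding * 0 using r by (simp add: nat_diff_distrib')
  moreover have "nat (k mod ?l) < CARD('l)"
    using r by linarith
  ultimately show ?thesis
    by (simp add: lring_cyc_def lring_coeff_X_mult)
qed

lemma lring_cyc_X_power_mult [simp]:
  "lring_cyc (lring_X ^ n * a) k = lring_cyc (a :: 'l::finite lring) (k - int n)"
  by (induction n arbitrary: k) (simp_all add: mult.assoc algebra_simps)

lemma lring_cyc_mult_X_power [simp]:
  "lring_cyc (a * lring_X ^ n) k = lring_cyc (a :: 'l::finite lring) (k - int n)"
  by (simp add: mult.commute[of a])

section \<open>The conjugation sending x to its inverse\<close>

lemma lring_bar_zero [simp]: "lring_bar 0 = 0"
  by transfer (simp add: lring_rel_def)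

lemma lring_bar_one [simp]: "lring_bar 1 = 1"
  by transfer (simp add: lring_rel_def pcompose_1)

lemma lring_bar_add [simp]: "lring_bar (a + b) = lring_bar a + lring_bar b"
  by transfer (simp add: lring_rel_def pcompose_add)

lemma lring_bar_mult [simp]: "lring_bar (a * b) = lring_bar a * lring_bar b"
  by transfer (simp add: lring_rel_def pcompose_mult)

lemma abs_lring_monom: "abs_lring (monom 1 n) = (lring_X ^ n :: 'l::finite lring)"
proof (induction n)
  case (Suc n)
  have "abs_lring (monom 1 (Suc n)) = (lring_X * abs_lring (monom 1 n) :: 'l lring)"
    by (simp add: lring_X_def times_lring.abs_eq mult_monom)
  then show ?case by (simp add: Suc)
qed (simp add: one_lring_def)

lemma lring_bar_X: "lring_bar lring_X = (lring_X ^ (CARD('l) - 1) :: 'l::finite lring)"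
proof -
  have "lring_bar lring_X = (abs_lring (monom 1 (CARD('l) - 1)) :: 'l lring)"
    by (simp add: lring_X_def lring_bar.abs_eq pcompose_monom_one)
  then show ?thesis by (simp add: abs_lring_monom)
qed

text \<open>\<open>lring_bar (lring_bar lring_X)\<close> and \<open>lring_X\<close> are both inverse
  to \<open>lring_bar lring_X\<close>, hence equal; the ring induction extends this to all
  elements.\<close>

lemma lring_bar_bar [simp]: "lring_bar (lring_bar a) = (a :: 'l::finite lring)"
proof (induction a rule: lring_induct)
  have "lring_bar (lring_bar lring_X) * lring_bar lring_X = (1 :: 'l lring)"
    using lring_X_inverse[where 'l='l]
    by (metis lring_bar_X lring_bar_mult lring_bar_one mult.commute)
  moreover have "lring_X * lring_bar lring_X = (1 :: 'l lring)"
    using lring_X_inverse[where 'l='l] by (simp add: lring_bar_X)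
  ultimately have X: "lring_bar (lring_bar lring_X) = (lring_X :: 'l lring)"
    by (metis mult.assoc mult.commute mult.right_neutral)
  { case zero show ?case by simp }
  { case (X_mult a) then show ?case by (simp add: X) }
  { case (one_plus_X_mult a) then show ?case by (simp add: X) }
qed

lemma lring_cyc_bar [simp]: "lring_cyc (lring_bar a) k = lring_cyc (a :: 'l::finite lring) (- k)"
proof (induction a arbitrary: k rule: lring_induct)
  \<comment> \<open>\<open>lring_bar lring_X\<close> is the inverse of \<open>lring_X\<close>, so
    multiplying by it moves indices in the opposite direction.\<close>
  have Xb: "lring_cyc (lring_bar lring_X * b) k = lring_cyc (b :: 'l lring) (k + 1)" for b k
  proof -
    have "lring_cyc b (k + 1) = lring_cyc (lring_X * (lring_bar lring_X * b)) (k + 1)"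
      using lring_X_inverse[where 'l='l] by (simp add: lring_bar_X flip: mult.assoc)
    then show ?thesis by simp
  qed
  { case zero show ?case by simp }
  { case (X_mult a) then show ?case by (simp add: Xb) }
  { case (one_plus_X_mult a)
    then show ?case by (simp add: Xb lring_cyc_one) }
qed

section \<open>Operators\<close>

lemma op_mult_assoc:
  assumes "finite Q"
  shows "op_mult Q (op_mult Q A B) C = op_mult Q A (op_mult Q B C)"
proof (intro ext)
  fix S T
  have "op_mult Q (op_mult Q A B) C S T = (\<Sum>V\<in>Pow Q. \<Sum>U\<in>Pow Q. A S U * B U V * C V T)"
    by (simp add: op_mult_def sum_distrib_right)
  also have "\<dots> = (\<Sum>U\<in>Pow Q. \<Sum>V\<in>Pow Q. A S U * B U V * C V T)"
    by (rule sum.swap)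
  finally show "op_mult Q (op_mult Q A B) C S T = op_mult Q A (op_mult Q B C) S T"
    by (simp add: op_mult_def sum_distrib_left mult.assoc)
qed

lemma op_adjoint_mult: "op_adjoint (op_mult Q M N) = op_mult Q (op_adjoint N) (op_adjoint M)"
  by (intro ext) (simp add: op_adjoint_def op_mult_def mult.commute)

lemma op_adjoint_adjoint [simp]: "op_adjoint (op_adjoint M) = M"
  by (intro ext) (simp add: op_adjoint_def)

lemma op_mult_one_left:
  assumes "finite Q" "\<And>S T. \<not> S \<subseteq> Q \<Longrightarrow> M S T = 0"
  shows "op_mult Q (op_one Q) M = M"
proof (intro ext)
  fix S T
  have "op_mult Q (op_one Q) M S T = (\<Sum>U\<in>Pow Q. if U = S then M U T else 0)"
    unfolding op_mult_def op_one_def by (rule sum.cong) auto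
  also have "\<dots> = M S T"
    using assms by (simp add: sum.delta')
  finally show "op_mult Q (op_one Q) M S T = M S T" .
qed

lemma op_mult_one_right:
  assumes "finite Q" "\<And>S T. \<not> T \<subseteq> Q \<Longrightarrow> M S T = 0"
  shows "op_mult Q M (op_one Q) = M"
proof (intro ext)
  fix S T
  have "op_mult Q M (op_one Q) S T = (\<Sum>U\<in>Pow Q. if U = T then M S U else 0)"
    unfolding op_mult_def op_one_def by (rule sum.cong) auto
  also have "\<dots> = M S T"
    using assms by (simp add: sum.delta')
  finally show "op_mult Q M (op_one Q) S T = M S T" .
qed

section \<open>The group of unitary operators and conjugation in it\<close>

lemma mem_unitary_group:
  "M \<in> carrier (unitary_group Q) \<longleftrightarrow>
     (\<forall>S T. \<not> (S \<subseteq> Q \<and> T \<subseteq> Q) \<longrightarrow> M S T = 0) \<and>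
     op_mult Q M (op_adjoint M) = op_one Q \<and> op_mult Q (op_adjoint M) M = op_one Q"
  by (simp add: unitary_group_def)

lemma unitary_groupI:
  assumes "\<And>S T. M S T \<noteq> 0 \<Longrightarrow> S \<subseteq> Q \<and> T \<subseteq> Q"
    and "op_mult Q M (op_adjoint M) = op_one Q" "op_mult Q (op_adjoint M) M = op_one Q"
  shows "M \<in> carrier (unitary_group Q)"
  using assms unfolding mem_unitary_group by blast

lemma unitary_group_simps [simp]:
  "\<one>\<^bsub>unitary_group Q\<^esub> = op_one Q"
  "M \<otimes>\<^bsub>unitary_group Q\<^esub> N = op_mult Q M N"
  by (simp_all add: unitary_group_def)

lemma unitary_op_mult_one:
  assumes "finite Q" "M \<in> carrier (unitary_group Q)"
  shows "op_mult Q (op_one Q) M = M" "op_mult Q M (op_one Q) = M"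
  using assms by (auto simp: mem_unitary_group intro!: op_mult_one_left op_mult_one_right)

lemma op_adjoint_unitary:
  "M \<in> carrier (unitary_group Q) \<Longrightarrow> op_adjoint M \<in> carrier (unitary_group Q)"
  by (auto simp: mem_unitary_group) (auto simp: op_adjoint_def)

lemma op_mult_unitary:
  assumes Q: "finite Q" and M: "M \<in> carrier (unitary_group Q)" and N: "N \<in> carrier (unitary_group Q)"
  shows "op_mult Q M N \<in> carrier (unitary_group Q)"
proof -
  note A = op_mult_assoc[OF Q]
  have "op_mult Q (op_mult Q M N) (op_adjoint (op_mult Q M N)) =
      op_mult Q M (op_mult Q (op_mult Q N (op_adjoint N)) (op_adjoint M))"
    by (simp add: op_adjoint_mult A)
  also have "\<dots> = op_one Q"
    using M N unitary_op_mult_one[OF Q op_adjoint_unitary[OF M]] by (simp add: mem_unitary_group)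
  finally have 1: "op_mult Q (op_mult Q M N) (op_adjoint (op_mult Q M N)) = op_one Q" .
  have "op_mult Q (op_adjoint (op_mult Q M N)) (op_mult Q M N) =
      op_mult Q (op_adjoint N) (op_mult Q (op_mult Q (op_adjoint M) M) N)"
    by (simp add: op_adjoint_mult A)
  also have "\<dots> = op_one Q"
    using M N unitary_op_mult_one[OF Q N] by (simp add: mem_unitary_group)
  finally have 2: "op_mult Q (op_adjoint (op_mult Q M N)) (op_mult Q M N) = op_one Q" .
  show ?thesis
  proof (rule unitary_groupI[OF _ 1 2])
    fix S T
    assume "op_mult Q M N S T \<noteq> 0"
    then obtain U where "M S U * N U T \<noteq> 0"
      unfolding op_mult_def by (rule sum.not_neutral_contains_not_neutral)
    then show "S \<subseteq> Q \<and> T \<subseteq> Q"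
      using M N unfolding mem_unitary_group by (metis mult_zero_left mult_zero_right)
  qed
qed

lemma op_one_unitary: "finite Q \<Longrightarrow> op_one Q \<in> carrier (unitary_group Q)"
proof -
  assume Q: "finite Q"
  have "op_adjoint (op_one Q) = op_one Q"
    by (intro ext) (auto simp: op_adjoint_def op_one_def)
  moreover have "op_mult Q (op_one Q) (op_one Q) = op_one Q"
    by (rule op_mult_one_left[OF Q]) (simp add: op_one_def)
  ultimately show ?thesis
    by (intro unitary_groupI) (simp_all add: op_one_def split: if_splits)
qed

lemma group_unitary_group:
  assumes Q: "finite Q"
  shows "group (unitary_group Q)"
proof (rule groupI)
  fix M assume M: "M \<in> carrier (unitary_group Q)"
  then show "\<exists>N\<in>carrier (unitary_group Q). N \<otimes>\<^bsub>unitary_group Q\<^esub> M = \<one>\<^bsub>unitary_group Q\<^esub>"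
    by (intro bexI[OF _ op_adjoint_unitary[OF M]]) (simp add: mem_unitary_group)
qed (use Q in \<open>simp_all add: op_mult_unitary op_one_unitary op_mult_assoc unitary_op_mult_one\<close>)

text \<open>Reduces every conjugation to an intertwining relation in which the adjoint of
  \<open>U\<close> no longer occurs; all Pauli images below are computed this way.\<close>

lemma op_conj_eqI:
  assumes Q: "finite Q" and U: "U \<in> carrier (unitary_group Q)" and P': "P' \<in> carrier (unitary_group Q)"
    and comm: "op_mult Q U P = op_mult Q P' U"
  shows "op_conj Q U P = P'"
proof -
  have "op_conj Q U P = op_mult Q (op_mult Q U P) (op_adjoint U)"
    by (simp add: op_conj_def op_mult_assoc[OF Q])
  also have "\<dots> = op_mult Q P' (op_mult Q U (op_adjoint U))"
    by (simp add: comm op_mult_assoc[OF Q])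
  also have "\<dots> = P'"
    using U unitary_op_mult_one[OF Q P'] by (simp add: mem_unitary_group)
  finally show ?thesis .
qed

lemma op_conj_mult:
  assumes Q: "finite Q" and U: "U \<in> carrier (unitary_group Q)" and N: "N \<in> carrier (unitary_group Q)"
  shows "op_conj Q U (op_mult Q M N) = op_mult Q (op_conj Q U M) (op_conj Q U N)"
proof -
  have "op_mult Q (op_conj Q U M) (op_conj Q U N) =
      op_mult Q U (op_mult Q M (op_mult Q (op_mult Q (op_adjoint U) U) (op_mult Q N (op_adjoint U))))"
    by (simp add: op_conj_def op_mult_assoc[OF Q])
  also have "\<dots> = op_mult Q U (op_mult Q M (op_mult Q N (op_adjoint U)))"
    using U unitary_op_mult_one(1)[OF Q op_mult_unitary[OF Q N op_adjoint_unitary[OF U]]]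
    by (simp add: mem_unitary_group)
  finally show ?thesis by (simp add: op_conj_def op_mult_assoc[OF Q])
qed

lemma op_conj_hom:
  assumes Q: "finite Q" and U: "U \<in> carrier (unitary_group Q)"
  shows "group_hom (unitary_group Q) (unitary_group Q) (op_conj Q U)"
proof (intro group_hom.intro group_hom_axioms.intro group_unitary_group[OF Q] homI)
  fix M N assume "M \<in> carrier (unitary_group Q)" "N \<in> carrier (unitary_group Q)"
  then show "op_conj Q U M \<in> carrier (unitary_group Q)"
    "op_conj Q U (M \<otimes>\<^bsub>unitary_group Q\<^esub> N) = op_conj Q U M \<otimes>\<^bsub>unitary_group Q\<^esub> op_conj Q U N"
    using Q U by (simp_all add: op_conj_mult) (simp add: op_conj_def op_mult_unitary op_adjoint_unitary)
qed

text \<open>Conjugation is a homomorphism, so both the generated subgroup and its image are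
  subgroups; each inclusion then only has to be checked on the generators.\<close>

lemma op_conj_generate:
  assumes Q: "finite Q" and U: "U \<in> carrier (unitary_group Q)" and K: "K \<subseteq> carrier (unitary_group Q)"
    and into: "\<And>k. k \<in> K \<Longrightarrow> op_conj Q U k \<in> generate (unitary_group Q) K"
    and onto: "\<And>k. k \<in> K \<Longrightarrow> k \<in> op_conj Q U ` generate (unitary_group Q) K"
  shows "op_conj Q U ` generate (unitary_group Q) K = generate (unitary_group Q) K"
proof -
  interpret G: group "unitary_group Q" by (rule group_unitary_group[OF Q])
  interpret group_hom "unitary_group Q" "unitary_group Q" "op_conj Q U" by (rule op_conj_hom[OF Q U])
  note sub = G.generate_is_subgroup[OF K]
  have "op_conj Q U ` generate (unitary_group Q) K \<subseteq> generate (unitary_group Q) K"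
    unfolding generate_img[OF K, symmetric] using into by (intro G.generate_subgroup_incl[OF _ sub]) auto
  moreover have "generate (unitary_group Q) K \<subseteq> op_conj Q U ` generate (unitary_group Q) K"
    using onto by (intro G.generate_subgroup_incl[OF _ subgroup_img_is_subgroup[OF sub]]) auto
  ultimately show ?thesis by blast
qed

section \<open>Monomial operators\<close>

text \<open>A generalized permutation matrix: it sends the basis vector \<open>T\<close> to
  \<open>c T\<close> times the basis vector \<open>f T\<close>. Paulis, qubit permutations and
  diagonal gates all have this form, and their products reduce to composing \<open>f\<close> and
  multiplying \<open>c\<close>.\<close>

definition mono_op :: "'q set \<Rightarrow> ('q set \<Rightarrow> 'q set) \<Rightarrow> ('q set \<Rightarrow> complex) \<Rightarrow> 'q oper" where
  "mono_op Q f c = (\<lambda>S T. if T \<subseteq> Q \<and> S = f T then c T else 0)"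

lemma mono_op_cong:
  "(\<And>T. T \<subseteq> Q \<Longrightarrow> f T = g T) \<Longrightarrow> (\<And>T. T \<subseteq> Q \<Longrightarrow> c T = d T) \<Longrightarrow> mono_op Q f c = mono_op Q g d"
  by (intro ext) (auto simp: mono_op_def)

lemma op_mult_mono_op:
  assumes "finite Q" "\<And>T. T \<subseteq> Q \<Longrightarrow> g T \<subseteq> Q"
  shows "op_mult Q (mono_op Q f c) (mono_op Q g d) = mono_op Q (\<lambda>T. f (g T)) (\<lambda>T. c (g T) * d T)"
proof (intro ext)
  fix S T
  have "op_mult Q (mono_op Q f c) (mono_op Q g d) S T =
      (\<Sum>U\<in>Pow Q. if U = g T then mono_op Q f c S U * (if T \<subseteq> Q then d T else 0) else 0)"
    unfolding op_mult_def mono_op_def by (rule sum.cong) auto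
  also have "\<dots> = mono_op Q (\<lambda>T. f (g T)) (\<lambda>T. c (g T) * d T) S T"
    using assms by (auto simp: sum.delta mono_op_def)
  finally show "op_mult Q (mono_op Q f c) (mono_op Q g d) S T =
      mono_op Q (\<lambda>T. f (g T)) (\<lambda>T. c (g T) * d T) S T" .
qed

lemma mono_op_unitary:
  assumes Q: "finite Q" and f: "bij_betw f (Pow Q) (Pow Q)" and c: "\<And>T. T \<subseteq> Q \<Longrightarrow> cmod (c T) = 1"
  shows "mono_op Q f c \<in> carrier (unitary_group Q)"
proof -
  let ?M = "mono_op Q f c"
  have fQ: "f T \<subseteq> Q" if "T \<subseteq> Q" for T
    using bij_betw_apply[OF f] that by blast
  have inj: "f S = f T \<longleftrightarrow> S = T" if "S \<subseteq> Q" "T \<subseteq> Q" for S T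
    using f that by (auto simp: bij_betw_def inj_on_def)
  have cc: "c T * cnj (c T) = 1" if "T \<subseteq> Q" for T
    using c[OF that] by (simp add: complex_norm_square[symmetric])
  have "op_mult Q ?M (op_adjoint ?M) S T = op_one Q S T" for S T
  proof -
    have "op_mult Q ?M (op_adjoint ?M) S T = (\<Sum>V\<in>Pow Q. if S = f V \<and> S = T then 1 else 0)"
      unfolding op_mult_def op_adjoint_def mono_op_def by (rule sum.cong) (auto simp: cc)
    \<comment> \<open>Reindexing along the bijection \<open>f\<close> leaves a sum with at most one
      nonzero term.\<close>
    also have "\<dots> = (\<Sum>W\<in>Pow Q. if S = W \<and> S = T then 1 else 0)"
      by (rule sum.reindex_bij_betw[OF f])
    also have "\<dots> = op_one Q S T"
      using Q by (cases "S = T") (auto simp: op_one_def)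
    finally show ?thesis .
  qed
  moreover have "op_mult Q (op_adjoint ?M) ?M S T = op_one Q S T" for S T
  proof -
    have "op_mult Q (op_adjoint ?M) ?M S T =
        (\<Sum>V\<in>Pow Q. if V = f S then (if S \<subseteq> Q \<and> S = T then 1 else 0) else 0)"
      unfolding op_mult_def op_adjoint_def mono_op_def
      by (rule sum.cong) (auto simp: cc[unfolded mult.commute[of _ "cnj _"]] inj)
    also have "\<dots> = op_one Q S T"
      using Q fQ by (auto simp: op_one_def sum.delta)
    finally show ?thesis .
  qed
  ultimately show ?thesis
    using fQ by (intro unitary_groupI ext) (simp_all add: mono_op_def split: if_splits)
qed

lemma op_one_mono_op: "op_one Q = mono_op Q (\<lambda>T. T) (\<lambda>_. 1)"
  by (intro ext) (auto simp: op_one_def mono_op_def)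

section \<open>Tensor products of one-qubit operators\<close>

lemma tensor_op_cong: "(\<And>q. q \<in> Q \<Longrightarrow> g q = h q) \<Longrightarrow> tensor_op Q g = tensor_op Q h"
  by (auto simp: tensor_op_def intro!: ext prod.cong)

lemma tensor_op_id1:
  assumes "finite Q"
  shows "tensor_op Q (\<lambda>_. id1) = op_one Q"
proof (intro ext)
  fix S T :: "'a set"
  have "(\<Prod>q\<in>Q. id1 (q \<in> S) (q \<in> T)) = 0" if "S \<subseteq> Q" "T \<subseteq> Q" "S \<noteq> T"
    using that assms by (intro prod_zero) (auto simp: id1_def)
  then show "tensor_op Q (\<lambda>_. id1) S T = op_one Q S T"
    by (auto simp: tensor_op_def op_one_def id1_def intro!: prod.neutral)
qed

text \<open>Tensor products multiply factor by factor. Expanding a product of two-term sums gives a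
  sum over subsets \<open>U\<close> of \<open>Q\<close>, namely the qubits whose intermediate bit is
  \<open>True\<close>; this is the sum over intermediate labels in \<open>op_mult\<close>.\<close>

lemma op_mult_tensor_op:
  assumes Q: "finite Q"
  shows "op_mult Q (tensor_op Q g) (tensor_op Q h) =
    tensor_op Q (\<lambda>q a b. g q a True * h q True b + g q a False * h q False b)"
proof (intro ext)
  fix S T :: "'a set"
  show "op_mult Q (tensor_op Q g) (tensor_op Q h) S T =
    tensor_op Q (\<lambda>q a b. g q a True * h q True b + g q a False * h q False b) S T"
  proof (cases "S \<subseteq> Q \<and> T \<subseteq> Q")
    case True
    have "(\<Prod>q\<in>U. g q (q \<in> S) True * h q True (q \<in> T)) * (\<Prod>q\<in>Q - U. g q (q \<in> S) False * h q False (q \<in> T)) =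
        (\<Prod>q\<in>Q. g q (q \<in> S) (q \<in> U)) * (\<Prod>q\<in>Q. h q (q \<in> U) (q \<in> T))" if "U \<in> Pow Q" for U
    proof -
      have "(\<Prod>q\<in>U. g q (q \<in> S) True * h q True (q \<in> T)) * (\<Prod>q\<in>Q - U. g q (q \<in> S) False * h q False (q \<in> T)) =
        (\<Prod>q\<in>Q - U. g q (q \<in> S) (q \<in> U) * h q (q \<in> U) (q \<in> T)) * (\<Prod>q\<in>U. g q (q \<in> S) (q \<in> U) * h q (q \<in> U) (q \<in> T))"
        by (subst mult.commute) (intro arg_cong2[where f="(*)"] prod.cong; auto)
      also have "\<dots> = (\<Prod>q\<in>Q. g q (q \<in> S) (q \<in> U) * h q (q \<in> U) (q \<in> T))"
        using that Q by (simp add: prod.subset_diff)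
      finally show ?thesis by (simp add: prod.distrib)
    qed
    then show ?thesis
      using True by (simp add: op_mult_def tensor_op_def prod_add[OF Q])
  next
    case False
    then show ?thesis
      by (cases "S \<subseteq> Q") (simp_all add: op_mult_def tensor_op_def)
  qed
qed

lemma tensor_op_unitary:
  assumes Q: "finite Q"
    and l: "\<And>q a b. q \<in> Q \<Longrightarrow> g q a True * cnj (g q b True) + g q a False * cnj (g q b False) = id1 a b"
    and r: "\<And>q a b. q \<in> Q \<Longrightarrow> cnj (g q True a) * g q True b + cnj (g q False a) * g q False b = id1 a b"
  shows "tensor_op Q g \<in> carrier (unitary_group Q)"
proof -
  have adj: "op_adjoint (tensor_op Q g) = tensor_op Q (\<lambda>q a b. cnj (g q b a))"
    by (auto simp: op_adjoint_def tensor_op_def intro!: ext)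
  have "op_mult Q (tensor_op Q g) (op_adjoint (tensor_op Q g)) = tensor_op Q (\<lambda>_. id1)"
    unfolding adj op_mult_tensor_op[OF Q] by (rule tensor_op_cong) (auto simp: l)
  moreover have "op_mult Q (op_adjoint (tensor_op Q g)) (tensor_op Q g) = tensor_op Q (\<lambda>_. id1)"
    unfolding adj op_mult_tensor_op[OF Q] by (rule tensor_op_cong) (auto simp: r)
  ultimately show ?thesis
    by (simp add: mem_unitary_group tensor_op_id1[OF Q]) (simp add: tensor_op_def)
qed

section \<open>Pauli operators and their images under permutations and Hadamards\<close>

text \<open>Flipping the bits in \<open>s\<close> is symmetric difference of labels; for any other
  pair of labels a single mismatched qubit contributes a zero factor.\<close>

lemma pauli_X_mono_op:
  assumes Q: "finite Q" and s: "s \<subseteq> Q"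
  shows "pauli_X Q s = mono_op Q (\<lambda>T. sym_diff T s) (\<lambda>_. 1)"
proof (intro ext)
  fix S T :: "'a set"
  let ?P = "\<Prod>q\<in>Q. (if q \<in> s then pauli_x1 else id1) (q \<in> S) (q \<in> T)"
  have "?P = 1" if "S = sym_diff T s"
    using that by (intro prod.neutral) (auto simp: pauli_x1_def id1_def)
  moreover have "?P = 0" if ST: "S \<subseteq> Q" "T \<subseteq> Q" "S \<noteq> sym_diff T s"
  proof -
    obtain q where "(q \<in> S) \<noteq> (q \<in> sym_diff T s)"
      using ST(3) by blast
    then show ?thesis
      using ST s by (intro prod_zero[OF Q] bexI[of _ q]) (auto simp: pauli_x1_def id1_def)
  qed
  ultimately show "pauli_X Q s S T = mono_op Q (\<lambda>T. sym_diff T s) (\<lambda>_. 1) S T"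
    using s by (auto simp: pauli_X_def tensor_op_def mono_op_def)
qed

lemma pauli_Z_mono_op:
  assumes Q: "finite Q"
  shows "pauli_Z Q s = mono_op Q (\<lambda>T. T) (\<lambda>T. (- 1) ^ card (T \<inter> s))"
proof (intro ext)
  fix S T :: "'a set"
  let ?P = "\<Prod>q\<in>Q. (if q \<in> s then pauli_z1 else id1) (q \<in> S) (q \<in> T)"
  have "?P = (- 1) ^ card (T \<inter> s)" if "S = T" "T \<subseteq> Q"
  proof -
    have "?P = (\<Prod>q\<in>Q. if q \<in> T \<inter> s then - 1 else 1)"
      using that by (intro prod.cong) (auto simp: pauli_z1_def id1_def)
    also have "\<dots> = (- 1) ^ card (Q \<inter> (T \<inter> s))"
      using Q by (simp only: prod.inter_restrict[symmetric] prod_constant)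
    also have "Q \<inter> (T \<inter> s) = T \<inter> s"
      using that by blast
    finally show ?thesis .
  qed
  moreover have "?P = 0" if ST: "S \<subseteq> Q" "T \<subseteq> Q" "S \<noteq> T"
  proof -
    obtain q where "(q \<in> S) \<noteq> (q \<in> T)"
      using ST(3) by blast
    then show ?thesis
      using ST by (intro prod_zero[OF Q] bexI[of _ q]) (auto simp: pauli_z1_def id1_def)
  qed
  ultimately show "pauli_Z Q s S T = mono_op Q (\<lambda>T. T) (\<lambda>T. (- 1) ^ card (T \<inter> s)) S T"
    by (auto simp: pauli_Z_def tensor_op_def mono_op_def)
qed

lemma bij_betw_sym_diff: "s \<subseteq> Q \<Longrightarrow> bij_betw (\<lambda>T. sym_diff T s) (Pow Q) (Pow Q)"
  by (rule bij_betw_byWitness[where f' = "\<lambda>T. sym_diff T s"]) auto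

lemma pauli_X_unitary: "finite Q \<Longrightarrow> s \<subseteq> Q \<Longrightarrow> pauli_X Q s \<in> carrier (unitary_group Q)"
  by (simp add: pauli_X_mono_op mono_op_unitary bij_betw_sym_diff)

lemma pauli_Z_unitary: "finite Q \<Longrightarrow> pauli_Z Q s \<in> carrier (unitary_group Q)"
  by (simp add: pauli_Z_mono_op mono_op_unitary norm_power bij_betw_id[unfolded id_def])

text \<open>In monomial form the X case says that the image under an injection commutes with
  symmetric difference, the Z case that it preserves the size of an intersection.\<close>

lemma op_conj_perm_op:
  assumes Q: "finite Q" and \<pi>: "bij_betw \<pi> Q Q"
  shows perm_op_unitary: "perm_op Q \<pi> \<in> carrier (unitary_group Q)"
    and op_conj_perm_op_pauli_X: "s \<subseteq> Q \<Longrightarrow> op_conj Q (perm_op Q \<pi>) (pauli_X Q s) = pauli_X Q (\<pi> ` s)"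
    and op_conj_perm_op_pauli_Z: "s \<subseteq> Q \<Longrightarrow> op_conj Q (perm_op Q \<pi>) (pauli_Z Q s) = pauli_Z Q (\<pi> ` s)"
proof -
  have P: "perm_op Q \<pi> = mono_op Q (image \<pi>) (\<lambda>_. 1)"
    by (intro ext) (auto simp: perm_op_def mono_op_def)
  show U: "perm_op Q \<pi> \<in> carrier (unitary_group Q)"
    unfolding P by (intro mono_op_unitary[OF Q] bij_betw_Pow[OF \<pi>]) simp
  have sub: "\<pi> ` T \<subseteq> Q" if "T \<subseteq> Q" for T
    using \<pi> that by (auto simp: bij_betw_def)
  have inj: "inj_on \<pi> Q"
    using \<pi> by (simp add: bij_betw_def)
  show "op_conj Q (perm_op Q \<pi>) (pauli_X Q s) = pauli_X Q (\<pi> ` s)" if s: "s \<subseteq> Q"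
  proof (rule op_conj_eqI[OF Q U pauli_X_unitary[OF Q sub[OF s]]])
    show "op_mult Q (perm_op Q \<pi>) (pauli_X Q s) = op_mult Q (pauli_X Q (\<pi> ` s)) (perm_op Q \<pi>)"
      unfolding P pauli_X_mono_op[OF Q s] pauli_X_mono_op[OF Q sub[OF s]]
    proof (subst (1 2) op_mult_mono_op[OF Q])
      show "mono_op Q (\<lambda>T. \<pi> ` sym_diff T s) (\<lambda>T. 1 * 1) =
          mono_op Q (\<lambda>T. sym_diff (\<pi> ` T) (\<pi> ` s)) (\<lambda>T. 1 * 1)"
        using s by (intro mono_op_cong) (simp_all add: image_Un inj_on_image_set_diff[OF inj] Diff_subset[THEN subset_trans])
    qed (use s sub in auto)
  qed
  show "op_conj Q (perm_op Q \<pi>) (pauli_Z Q s) = pauli_Z Q (\<pi> ` s)" if s: "s \<subseteq> Q"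
  proof (rule op_conj_eqI[OF Q U pauli_Z_unitary[OF Q]])
    have "card (\<pi> ` T \<inter> \<pi> ` s) = card (T \<inter> s)" if "T \<subseteq> Q" for T
    proof -
      have "\<pi> ` T \<inter> \<pi> ` s = \<pi> ` (T \<inter> s)"
        using inj_on_image_Int[OF inj that s] by simp
      then show ?thesis
        using card_image[OF inj_on_subset[OF inj]] that by (metis Int_lower1 subset_trans)
    qed
    then show "op_mult Q (perm_op Q \<pi>) (pauli_Z Q s) = op_mult Q (pauli_Z Q (\<pi> ` s)) (perm_op Q \<pi>)"
      unfolding P pauli_Z_mono_op[OF Q]
      by (subst (1 2) op_mult_mono_op[OF Q]) (use sub in \<open>auto intro: mono_op_cong\<close>)
  qed
qed

lemma op_conj_op_mult:
  assumes Q: "finite Q"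
  shows "op_conj Q (op_mult Q U V) P = op_conj Q U (op_conj Q V P)"
  by (simp add: op_conj_def op_adjoint_mult op_mult_assoc[OF Q])

text \<open>Stated for an arbitrary set \<open>s\<close> so that the induction can remove one qubit
  at a time; distinctness of the list keeps a removed qubit from reappearing.\<close>

lemma circuit_op_Hadamard:
  assumes Q: "finite Q"
  shows "distinct gs \<Longrightarrow> set gs = Hadamard ` s \<Longrightarrow>
    circuit_op Q gs = tensor_op Q (\<lambda>q. if q \<in> s then hadamard1 else id1)"
proof (induction gs arbitrary: s)
  case Nil
  then show ?case by (simp add: tensor_op_id1[OF Q])
next
  case (Cons g gs)
  then obtain p where p: "g = Hadamard p" "p \<in> s" by (metis imageE list.set_intros(1))
  then have "set gs = Hadamard ` (s - {p})"
    using Cons.prems by auto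
  then have IH: "circuit_op Q gs = tensor_op Q (\<lambda>q. if q \<in> s - {p} then hadamard1 else id1)"
    using Cons by simp
  show ?case
    by (simp add: IH p(1) op_mult_tensor_op[OF Q])
      (rule tensor_op_cong, auto simp: fun_eq_iff id1_def p(2))
qed

text \<open>Tensor products multiply factorwise, so everything reduces to the one-qubit identities
  HX = ZH, HZ = XH and the unitarity of H.\<close>

lemma op_conj_Hadamard:
  assumes Q: "finite Q" and gs: "distinct gs" "set gs = Hadamard ` Q"
  shows circuit_op_Hadamard_unitary: "circuit_op Q gs \<in> carrier (unitary_group Q)"
    and op_conj_Hadamard_pauli_X: "s \<subseteq> Q \<Longrightarrow> op_conj Q (circuit_op Q gs) (pauli_X Q s) = pauli_Z Q s"
    and op_conj_Hadamard_pauli_Z: "s \<subseteq> Q \<Longrightarrow> op_conj Q (circuit_op Q gs) (pauli_Z Q s) = pauli_X Q s"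
proof -
  have H: "circuit_op Q gs = tensor_op Q (\<lambda>_. hadamard1)"
    unfolding circuit_op_Hadamard[OF Q gs] by (rule tensor_op_cong) simp
  have sq: "complex_of_real (sqrt 2) * complex_of_real (sqrt 2) = 2"
    by (simp flip: of_real_mult)
  show U: "circuit_op Q gs \<in> carrier (unitary_group Q)"
    unfolding H by (rule tensor_op_unitary[OF Q]) (auto simp: hadamard1_def id1_def sq)
  show "op_conj Q (circuit_op Q gs) (pauli_X Q s) = pauli_Z Q s" if "s \<subseteq> Q"
    unfolding H
    by (rule op_conj_eqI[OF Q U[unfolded H] pauli_Z_unitary[OF Q]], unfold pauli_X_def pauli_Z_def op_mult_tensor_op[OF Q])
      (rule tensor_op_cong, auto simp: fun_eq_iff hadamard1_def pauli_x1_def pauli_z1_def id1_def)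
  show "op_conj Q (circuit_op Q gs) (pauli_Z Q s) = pauli_X Q s" if "s \<subseteq> Q"
    unfolding H
    by (rule op_conj_eqI[OF Q U[unfolded H] pauli_X_unitary[OF Q that]], unfold pauli_X_def pauli_Z_def op_mult_tensor_op[OF Q])
      (rule tensor_op_cong, auto simp: fun_eq_iff hadamard1_def pauli_x1_def pauli_z1_def id1_def)
qed

section \<open>Transversal circuits of $S$, $S^\dagger$ and $CZ$ gates\<close>

lemma tensor_op_diagonal:
  assumes Q: "finite Q" and g: "\<And>q a b. q \<in> Q \<Longrightarrow> a \<noteq> b \<Longrightarrow> g q a b = 0"
  shows "tensor_op Q g = mono_op Q (\<lambda>T. T) (\<lambda>T. \<Prod>q\<in>Q. g q (q \<in> T) (q \<in> T))"
proof (intro ext)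
  fix S T :: "'a set"
  have "(\<Prod>q\<in>Q. g q (q \<in> S) (q \<in> T)) = 0" if ST: "S \<subseteq> Q" "T \<subseteq> Q" "S \<noteq> T"
  proof -
    obtain q where "(q \<in> S) \<noteq> (q \<in> T)"
      using ST(3) by blast
    then have "q \<in> Q" "g q (q \<in> S) (q \<in> T) = 0"
      using ST g by blast+
    then show ?thesis
      by (intro prod_zero[OF Q] bexI)
  qed
  then show "tensor_op Q g S T = mono_op Q (\<lambda>T. T) (\<lambda>T. \<Prod>q\<in>Q. g q (q \<in> T) (q \<in> T)) S T"
    by (auto simp: tensor_op_def mono_op_def)
qed

text \<open>The eigenvalue of a diagonal gate on the basis vector \<open>T\<close>. The value at
  \<open>Hadamard\<close> is a placeholder; \<open>gate_op_diagonal\<close> excludes that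
  gate.\<close>

fun gate_phase :: "'q gate \<Rightarrow> 'q set \<Rightarrow> complex" where
  "gate_phase (Hadamard q) T = 1"
| "gate_phase (Phase q) T = (if q \<in> T then \<i> else 1)"
| "gate_phase (PhaseDag q) T = (if q \<in> T then - \<i> else 1)"
| "gate_phase (CZ p q) T = (if p \<in> T \<and> q \<in> T then - 1 else 1)"

definition is_Hadamard :: "'q gate \<Rightarrow> bool" where
  "is_Hadamard g \<longleftrightarrow> (\<exists>q. g = Hadamard q)"

lemma norm_gate_phase [simp]: "cmod (gate_phase g T) = 1"
  by (cases g) simp_all

lemma gate_phase_cong:
  "(\<And>q. q \<in> gate_qubits g \<Longrightarrow> q \<in> S \<longleftrightarrow> q \<in> T) \<Longrightarrow> gate_phase g S = gate_phase g T"
  by (cases g) auto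

lemma gate_op_diagonal:
  assumes Q: "finite Q" and g: "\<not> is_Hadamard g"
  shows "gate_op Q g = mono_op Q (\<lambda>T. T) (gate_phase g)"
proof -
  \<comment> \<open>Common to \<open>Phase\<close> and \<open>PhaseDag\<close>: every factor away
    from \<open>p\<close> is 1, so the entry depends only on whether \<open>p\<close> lies in
    \<open>T\<close>.\<close>
  have 1: "tensor_op Q ((\<lambda>_. id1)(p := h)) = mono_op Q (\<lambda>T. T) (\<lambda>T. if p \<in> T then h True True else 1)"
    if h: "h False False = 1" "h True False = 0" "h False True = 0" for p h
  proof (subst tensor_op_diagonal[OF Q], rule_tac [2] mono_op_cong)
    fix q a b
    show "((\<lambda>_. id1)(p := h)) q a b = 0" if "a \<noteq> b"
      using that h by (cases a; cases b) (auto simp: id1_def)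
  next
    fix T assume T: "T \<subseteq> Q"
    have "(\<Prod>q\<in>Q. ((\<lambda>_. id1)(p := h)) q (q \<in> T) (q \<in> T)) =
        (\<Prod>q\<in>Q. if q = p then (if p \<in> T then h True True else 1) else 1)"
      using h by (intro prod.cong) (auto simp: id1_def)
    also have "\<dots> = (if p \<in> T then h True True else 1)"
      using T Q by (auto simp: prod.delta)
    finally show "(\<Prod>q\<in>Q. ((\<lambda>_. id1)(p := h)) q (q \<in> T) (q \<in> T)) = (if p \<in> T then h True True else 1)" .
  qed simp
  show ?thesis
  proof (cases g)
    case (CZ p q)
    then show ?thesis by (intro ext) (auto simp: mono_op_def)
  qed (use g in \<open>auto simp: is_Hadamard_def 1 phase1_def phase_dag1_def intro!: mono_op_cong\<close>)
qed

lemma circuit_op_diagonal: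
  assumes Q: "finite Q"
  shows "distinct gs \<Longrightarrow> (\<And>g. g \<in> set gs \<Longrightarrow> \<not> is_Hadamard g) \<Longrightarrow>
    circuit_op Q gs = mono_op Q (\<lambda>T. T) (\<lambda>T. \<Prod>g\<in>set gs. gate_phase g T)"
proof (induction gs)
  case Nil
  show ?case by (simp add: op_one_mono_op)
next
  case (Cons g gs)
  then show ?case
    by (simp add: gate_op_diagonal[OF Q] op_mult_mono_op[OF Q] mult.commute)
qed

text \<open>For a symmetric relation the order of the list is irrelevant, which turns
  \<open>depth_one\<close> into a condition on the set of gates.\<close>

lemma sorted_wrt_distinct_iff:
  assumes "symp R" "distinct xs"
  shows "sorted_wrt R xs \<longleftrightarrow> (\<forall>x\<in>set xs. \<forall>y\<in>set xs. x \<noteq> y \<longrightarrow> R x y)"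
  using assms(2) by (induction xs) (auto dest: sympD[OF assms(1)])

lemma depth_one_iff:
  assumes "distinct gs"
  shows "depth_one gs \<longleftrightarrow> (\<forall>g\<in>set gs. \<forall>h\<in>set gs. g \<noteq> h \<longrightarrow> gate_qubits g \<inter> gate_qubits h = {})"
  unfolding depth_one_def by (rule sorted_wrt_distinct_iff[OF _ assms]) (auto simp: symp_def)

section \<open>The diagonal circuit of an arbitrary involution\<close>

text \<open>The circuit depends only on how \<tau> acts on the qubits: a phase gate on each fixed
  point, a \<open>CZ\<close> on each two-element orbit. The order \<open>lt\<close> selects one
  orientation per orbit, so that each \<open>CZ\<close> occurs once.\<close>

locale involution_circuit =
  fixes Q :: "'q set" and \<tau> :: "'q \<Rightarrow> 'q" and DL DR :: "'q set" and lt :: "'q rel"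
    and gs :: "'q gate list"
  assumes finite_Q: "finite Q"
    and \<tau>_in: "q \<in> Q \<Longrightarrow> \<tau> q \<in> Q"
    and \<tau>_\<tau>: "q \<in> Q \<Longrightarrow> \<tau> (\<tau> q) = q"
    and fixed_points: "DL \<union> DR = {q \<in> Q. \<tau> q = q}"
    and DL_DR: "DL \<inter> DR = {}"
    and lt: "strict_linear_order_on Q lt"
    and distinct_gs: "distinct gs"
    and set_gs: "set gs = Phase ` DL \<union> PhaseDag ` DR \<union> {CZ q (\<tau> q) | q. q \<in> Q \<and> (q, \<tau> q) \<in> lt}"
begin

lemma lt_asym: "(p, q) \<in> lt \<Longrightarrow> (q, p) \<notin> lt" and lt_irrefl: "(q, q) \<notin> lt"
  using lt unfolding strict_linear_order_on_def by (auto dest: transD simp: irrefl_def)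

lemma depth_one_gs: "depth_one gs"
proof -
  have fix_DL: "\<tau> q = q" "q \<in> Q" if "q \<in> DL" for q using that fixed_points by auto
  have fix_DR: "\<tau> q = q" "q \<in> Q" if "q \<in> DR" for q using that fixed_points by auto
  have "gate_qubits g \<inter> gate_qubits h = {}" if gh: "g \<in> set gs" "h \<in> set gs" "g \<noteq> h" for g h
  proof (rule ccontr)
    assume "gate_qubits g \<inter> gate_qubits h \<noteq> {}"
    then obtain q where q: "q \<in> gate_qubits g" "q \<in> gate_qubits h" by blast
    \<comment> \<open>The orbits of \<tau> partition \<open>Q\<close>, and a gate touching
      \<open>q\<close> is one of the four possible gates on the orbit of \<open>q\<close>; two
      different ones never occur together.\<close>
    have cases: "(k = Phase q \<and> q \<in> DL) \<or> (k = PhaseDag q \<and> q \<in> DR) \<or>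
      (k = CZ q (\<tau> q) \<and> q \<in> Q \<and> (q, \<tau> q) \<in> lt) \<or> (k = CZ (\<tau> q) q \<and> q \<in> Q \<and> (\<tau> q, q) \<in> lt)"
      if "k \<in> set gs" "q \<in> gate_qubits k" for k
      using that unfolding set_gs by (auto simp: \<tau>_\<tau> \<tau>_in)
    show False
      using cases[OF gh(1) q(1)] cases[OF gh(2) q(2)] gh(3) fix_DL fix_DR DL_DR lt_asym lt_irrefl
      by (metis disjoint_iff)
  qed
  then show ?thesis
    unfolding depth_one_iff[OF distinct_gs] by blast
qed

lemma not_Hadamard: "g \<in> set gs \<Longrightarrow> \<not> is_Hadamard g"
  unfolding set_gs is_Hadamard_def by auto

definition circuit_phase :: "'q set \<Rightarrow> complex" where
  "circuit_phase T = (\<Prod>g\<in>set gs. gate_phase g T)"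

definition qubit_phase :: "'q \<Rightarrow> complex" where
  "qubit_phase q = (if q \<in> DL then \<i> else if q \<in> DR then - \<i> else 1)"

lemma circuit_op_eq: "circuit_op Q gs = mono_op Q (\<lambda>T. T) circuit_phase"
  unfolding circuit_phase_def by (rule circuit_op_diagonal[OF finite_Q distinct_gs not_Hadamard])

lemma circuit_unitary: "circuit_op Q gs \<in> carrier (unitary_group Q)"
  unfolding circuit_op_eq circuit_phase_def
  by (rule mono_op_unitary[OF finite_Q]) (simp_all add: prod_norm[symmetric] bij_betw_id[unfolded id_def])

text \<open>Only the gate on the orbit of \<open>q\<close> sees the flip. If \<open>q\<close> is a
  fixed point already in \<open>T\<close>, the factor -1 replaces the phase \<i> or -\<i> by its
  inverse, which is the effect of clearing the bit; otherwise the sign is that of the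
  \<open>CZ\<close> with the partner bit.\<close>

lemma circuit_phase_flip:
  assumes q: "q \<in> Q"
  shows "circuit_phase (sym_diff T {q}) = qubit_phase q * (if \<tau> q \<in> T then - 1 else 1) * circuit_phase T"
proof -
  have "\<exists>g\<in>set gs. q \<in> gate_qubits g \<and>
      gate_phase g (sym_diff T {q}) = qubit_phase q * (if \<tau> q \<in> T then - 1 else 1) * gate_phase g T"
  proof (cases "\<tau> q = q")
    case True
    then have "q \<in> DL \<or> q \<in> DR" using q fixed_points by blast
    then show ?thesis
    proof
      assume "q \<in> DL"
      then show ?thesis
        using True by (intro bexI[of _ "Phase q"]) (auto simp: set_gs qubit_phase_def)
    next
      assume "q \<in> DR"
      then show ?thesis
        using True DL_DR by (intro bexI[of _ "PhaseDag q"]) (auto simp: set_gs qubit_phase_def)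
    qed
  next
    case False
    then have 1: "qubit_phase q = 1"
      using fixed_points by (auto simp: qubit_phase_def)
    \<comment> \<open>Totality of \<open>lt\<close> provides the orientation in which the pair
      carries its \<open>CZ\<close>.\<close>
    have "(q, \<tau> q) \<in> lt \<or> (\<tau> q, q) \<in> lt"
      using lt q False \<tau>_in[OF q] by (auto simp: strict_linear_order_on_def total_on_def)
    then show ?thesis
    proof
      assume "(q, \<tau> q) \<in> lt"
      then show ?thesis
        using False q 1 by (intro bexI[of _ "CZ q (\<tau> q)"]) (auto simp: set_gs)
    next
      assume "(\<tau> q, q) \<in> lt"
      then have "CZ (\<tau> q) q \<in> set gs"
        using q \<tau>_in[OF q] \<tau>_\<tau>[OF q] by (auto simp: set_gs)
      then show ?thesis
        using False 1 by (intro bexI[of _ "CZ (\<tau> q) q"]) auto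
    qed
  qed
  then obtain g where g: "g \<in> set gs" "q \<in> gate_qubits g"
    "gate_phase g (sym_diff T {q}) = qubit_phase q * (if \<tau> q \<in> T then - 1 else 1) * gate_phase g T"
    by blast
  \<comment> \<open>By depth one no other gate acts on \<open>q\<close>, so the remaining phases are
    unchanged.\<close>
  have "(\<Prod>h\<in>set gs - {g}. gate_phase h (sym_diff T {q})) = (\<Prod>h\<in>set gs - {g}. gate_phase h T)"
  proof (rule prod.cong[OF refl], rule gate_phase_cong)
    fix h p assume h: "h \<in> set gs - {g}" "p \<in> gate_qubits h"
    have "gate_qubits g \<inter> gate_qubits h = {}"
      using depth_one_gs[unfolded depth_one_iff[OF distinct_gs]] g(1) h(1) by blast
    then show "p \<in> sym_diff T {q} \<longleftrightarrow> p \<in> T"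
      using g(2) h(2) by blast
  qed
  then show ?thesis
    unfolding circuit_phase_def using g by (simp add: prod.remove[OF _ g(1)])
qed

text \<open>
  No \<open>CZ\<close> gate joins two qubits of such a set, so commuting the \<open>Z\<close> factors past the \<open>X\<close> factors
  produces no sign.
\<close>

definition isolated :: "'q set \<Rightarrow> bool" where
  "isolated s \<longleftrightarrow> s \<subseteq> Q \<and> (\<forall>q\<in>s. \<tau> q \<in> s \<longrightarrow> \<tau> q = q)"

text \<open>The qubits of \<open>s\<close> are flipped one at a time. Isolation keeps
  \<open>\<tau> q\<close> outside the part already flipped, so whether it lies in the current label
  is still decided by \<open>T\<close>.\<close>

lemma circuit_phase_sym_diff:
  assumes "isolated s" "T \<subseteq> Q"
  shows "circuit_phase (sym_diff T s) = prod qubit_phase s * (- 1) ^ card (T \<inter> \<tau> ` s) * circuit_phase T"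
proof -
  have "finite s"
    using assms finite_Q by (auto simp: isolated_def intro: finite_subset)
  then show ?thesis
    using assms(1)
  proof (induction s)
    case (insert q s)
    have q: "q \<in> Q" "s \<subseteq> Q" and s: "isolated s" and "\<tau> q \<notin> s"
      using insert.prems insert.hyps \<tau>_\<tau> by (auto simp: isolated_def)
    \<comment> \<open>As \<tau> is injective on \<open>Q\<close>, \<open>\<tau> q\<close> is a new
      element of the image, and the exponent grows by one exactly when it lies in
      \<open>T\<close>.\<close>
    have "\<tau> q \<notin> \<tau> ` s"
      using insert.hyps q \<tau>_\<tau> by (metis imageE subsetD)
    then have card: "(if \<tau> q \<in> T then - 1 else 1) * (- 1) ^ card (T \<inter> \<tau> ` s) =
        ((- 1) ^ card (T \<inter> \<tau> ` insert q s) :: complex)"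
      using insert.hyps by (simp add: Int_insert_right)
    have "sym_diff T (insert q s) = sym_diff (sym_diff T s) {q}"
      using insert.hyps by blast
    then have "circuit_phase (sym_diff T (insert q s)) =
        qubit_phase q * (if \<tau> q \<in> T then - 1 else 1) *
          (prod qubit_phase s * (- 1) ^ card (T \<inter> \<tau> ` s) * circuit_phase T)"
      using \<open>\<tau> q \<notin> s\<close> by (simp only: circuit_phase_flip[OF q(1)] insert.IH[OF s]) simp
    also have "\<dots> = (qubit_phase q * prod qubit_phase s) *
        ((if \<tau> q \<in> T then - 1 else 1) * (- 1) ^ card (T \<inter> \<tau> ` s)) * circuit_phase T"
      by (simp only: ac_simps)
    finally show ?case
      unfolding card using insert.hyps by simp
  qed simp
qed

lemma prod_qubit_phase:
  assumes "s \<subseteq> Q"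
  shows "prod qubit_phase s = \<i> ^ card (s \<inter> DL) * (- \<i>) ^ card (s \<inter> DR)"
proof -
  have s: "finite s" using assms finite_Q by (rule finite_subset)
  have "prod qubit_phase s = (\<Prod>q\<in>s. (if q \<in> DL then \<i> else 1) * (if q \<in> DR then - \<i> else 1))"
    using DL_DR by (intro prod.cong) (auto simp: qubit_phase_def)
  then show ?thesis
    using s by (simp only: prod.distrib prod.inter_restrict[symmetric] prod_constant)
qed

lemma op_conj_circuit_pauli_Z: "op_conj Q (circuit_op Q gs) (pauli_Z Q s) = pauli_Z Q s"
  by (rule op_conj_eqI[OF finite_Q circuit_unitary pauli_Z_unitary[OF finite_Q]])
    (simp add: circuit_op_eq pauli_Z_mono_op finite_Q op_mult_mono_op mult.commute)

lemma op_conj_circuit_pauli_X: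
  assumes s: "isolated s"
  shows "op_conj Q (circuit_op Q gs) (pauli_X Q s) =
    op_scale (prod qubit_phase s) (op_mult Q (pauli_X Q s) (pauli_Z Q (\<tau> ` s)))" (is "_ = ?P")
proof -
  have sQ: "s \<subseteq> Q" using s by (simp add: isolated_def)
  have sub: "sym_diff T s \<subseteq> Q" if "T \<subseteq> Q" for T
    using that sQ by blast
  have scale: "op_scale c (mono_op Q f d) = mono_op Q f (\<lambda>T. c * d T)" for c f d
    by (intro ext) (simp add: op_scale_def mono_op_def)
  have P: "?P = mono_op Q (\<lambda>T. sym_diff T s) (\<lambda>T. prod qubit_phase s * (- 1) ^ card (T \<inter> \<tau> ` s))"
    by (simp add: pauli_X_mono_op pauli_Z_mono_op finite_Q sQ op_mult_mono_op scale)
  have "cmod (qubit_phase q) = 1" for q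
    by (simp add: qubit_phase_def)
  then have "?P \<in> carrier (unitary_group Q)"
    unfolding P
    by (intro mono_op_unitary[OF finite_Q bij_betw_sym_diff[OF sQ]])
      (simp add: norm_mult norm_power prod_norm[symmetric])
  then show ?thesis
  proof (rule op_conj_eqI[OF finite_Q circuit_unitary])
    show "op_mult Q (circuit_op Q gs) (pauli_X Q s) = op_mult Q ?P (circuit_op Q gs)"
      unfolding P unfolding circuit_op_eq pauli_X_mono_op[OF finite_Q sQ]
      by (subst (1 2) op_mult_mono_op[OF finite_Q])
        (use sub circuit_phase_sym_diff[OF s] in \<open>auto intro!: mono_op_cong\<close>)
  qed
qed

end

section \<open>Supports of checks and logical operators\<close>

text \<open>A natural number congruent to -t modulo l, giving the inverse shift; its value is l when
  l divides t.\<close>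

definition opposite_shift :: "nat \<Rightarrow> nat \<Rightarrow> nat" where
  "opposite_shift l t = l - t mod l"

lemma shift_mod_cancel:
  fixes m t l :: nat
  assumes "m < l"
  shows "((m + t) mod l + opposite_shift l t) mod l = m"
    and "((m + opposite_shift l t) mod l + t) mod l = m"
proof -
  have "t mod l < l"
    using assms by simp
  then have "t + opposite_shift l t = l * (t div l + 1)"
    using mult_div_mod_eq[of l t] unfolding opposite_shift_def distrib_left mult_1_right by linarith
  then have "(m + (t + opposite_shift l t)) mod l = m"
    using assms by (simp only: mod_mult_self2 mod_less)
  then show "((m + t) mod l + opposite_shift l t) mod l = m"
    "((m + opposite_shift l t) mod l + t) mod l = m"
    by (simp_all only: mod_add_left_eq add.assoc add.commute[of "opposite_shift l t" t])
qed

lemma mem_qubits: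
  fixes A B :: "'l::finite lring mat"
  shows "q_L a b m \<in> qubits A B \<longleftrightarrow> a < dim_col A \<and> b < dim_row B \<and> m < CARD('l)"
    and "q_R a b m \<in> qubits A B \<longleftrightarrow> a < dim_row A \<and> b < dim_col B \<and> m < CARD('l)"
  by (auto simp: qubits_def)

lemma qubits_cases:
  fixes A B :: "'l::finite lring mat"
  assumes "q \<in> qubits A B"
  obtains a b m where "q = q_L a b m" "a < dim_col A" "b < dim_row B" "m < CARD('l)"
    | a b m where "q = q_R a b m" "a < dim_row A" "b < dim_col B" "m < CARD('l)"
  using assms unfolding qubits_def by blast

lemma finite_qubits: "finite (qubits (A :: 'l::finite lring mat) B)"
proof -
  have "qubits A B \<subseteq>
      (\<lambda>(i, j, m). q_L i j m) ` ({..<dim_col A} \<times> {..<dim_row B} \<times> {..<CARD('l)}) \<union>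
      (\<lambda>(i, j, m). q_R i j m) ` ({..<dim_row A} \<times> {..<dim_col B} \<times> {..<CARD('l)})"
    by (force simp: qubits_def)
  then show ?thesis by (rule finite_subset) simp
qed

lemma bij_betw_shift_qubit:
  fixes A B :: "'l::finite lring mat"
  shows "bij_betw (shift_qubit CARD('l) t) (qubits A B) (qubits A B)"
  by (rule bij_betw_byWitness[where f' = "shift_qubit CARD('l) (opposite_shift CARD('l) t)"])
    (auto simp: shift_qubit_def mem_qubits shift_mod_cancel elim!: qubits_cases)

lemma supp_restrict_vec_subset: "supp (restrict_vec Q v) \<subseteq> Q"
  by (auto simp: supp_def restrict_vec_def)

lemma mem_supp_restrict_vec: "q \<in> supp (restrict_vec Q v) \<longleftrightarrow> q \<in> Q \<and> v q = 1"
  by (auto simp: supp_def restrict_vec_def)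

text \<open>Transfers a coefficientwise identity between two vectors to their supports; it serves
  both the shift and the transposition.\<close>

lemma image_supp_restrict_vec:
  assumes "bij_betw \<pi> Q Q" "\<And>q. q \<in> Q \<Longrightarrow> w (\<pi> q) = v q"
  shows "\<pi> ` supp (restrict_vec Q v) = supp (restrict_vec Q w)"
proof -
  have "\<pi> ` Q = Q" using assms(1) by (simp add: bij_betw_def)
  show ?thesis
  proof (intro equalityI subsetI)
    fix p assume "p \<in> \<pi> ` supp (restrict_vec Q v)"
    then obtain q where "p = \<pi> q" "q \<in> supp (restrict_vec Q v)"
      by (rule imageE)
    then have "p = \<pi> q" "q \<in> Q" "v q = 1"
      unfolding mem_supp_restrict_vec by simp_all
    then show "p \<in> supp (restrict_vec Q w)"
      using \<open>\<pi> ` Q = Q\<close> assms(2)[OF \<open>q \<in> Q\<close>] unfolding mem_supp_restrict_vec by auto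
  next
    fix p assume "p \<in> supp (restrict_vec Q w)"
    then have "p \<in> \<pi> ` Q" "w p = 1"
      using \<open>\<pi> ` Q = Q\<close> unfolding mem_supp_restrict_vec by simp_all
    then obtain q where q: "p = \<pi> q" "q \<in> Q"
      by (elim imageE)
    then have "q \<in> supp (restrict_vec Q v)"
      using assms(2)[OF q(2)] \<open>w p = 1\<close> unfolding mem_supp_restrict_vec by simp
    then show "p \<in> \<pi> ` supp (restrict_vec Q v)"
      unfolding \<open>p = \<pi> q\<close> by (rule imageI)
  qed
qed

section \<open>Checks, stabilizer generators and criteria for logical gates\<close>

definition x_check :: "'l::finite lring mat \<Rightarrow> 'l lring mat \<Rightarrow> nat \<Rightarrow> nat \<Rightarrow> nat \<Rightarrow> qubit set" where
  "x_check A B r r' k = supp (restrict_vec (qubits A B) (bin_mat (H_X A B) ((r, r'), k)))"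

definition z_check :: "'l::finite lring mat \<Rightarrow> 'l lring mat \<Rightarrow> nat \<Rightarrow> nat \<Rightarrow> nat \<Rightarrow> qubit set" where
  "z_check A B r r' k = supp (restrict_vec (qubits A B) (bin_mat (H_Z A B) ((r, r'), k)))"

definition stabilizer_generators :: "'l::finite lring mat \<Rightarrow> 'l lring mat \<Rightarrow> qubit oper set" where
  "stabilizer_generators A B =
     {pauli_X (qubits A B) (x_check A B r r' k) | r r' k.
        r < dim_row A \<and> r' < dim_row B \<and> k < CARD('l)} \<union>
     {pauli_Z (qubits A B) (z_check A B r r' k) | r r' k.
        r < dim_col A \<and> r' < dim_col B \<and> k < CARD('l)}"

lemma pauli_X_mem_stabilizer_generators:
  fixes A B :: "'l::finite lring mat"
  assumes "r < dim_row A" "r' < dim_row B" "k < CARD('l)"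
  shows "pauli_X (qubits A B) (x_check A B r r' k) \<in> stabilizer_generators A B"
  using assms unfolding stabilizer_generators_def by blast

lemma pauli_Z_mem_stabilizer_generators:
  fixes A B :: "'l::finite lring mat"
  assumes "r < dim_col A" "r' < dim_col B" "k < CARD('l)"
  shows "pauli_Z (qubits A B) (z_check A B r r' k) \<in> stabilizer_generators A B"
  using assms unfolding stabilizer_generators_def by blast

lemma stabilizer_generators_cases:
  fixes A B :: "'l::finite lring mat"
  assumes "P \<in> stabilizer_generators A B"
  obtains
    r r' k where "P = pauli_X (qubits A B) (x_check A B r r' k)" "r < dim_row A" "r' < dim_row B" "k < CARD('l)"
  | r r' k where "P = pauli_Z (qubits A B) (z_check A B r r' k)" "r < dim_col A" "r' < dim_col B" "k < CARD('l)"
  using assms unfolding stabilizer_generators_def by blast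

lemma stabilizer_group_eq:
  "stabilizer_group A B = generate (unitary_group (qubits A B)) (stabilizer_generators A B)"
proof -
  have "(\<lambda>h. pauli_X (qubits A B) (supp h)) ` X_checks A B \<union>
      (\<lambda>h. pauli_Z (qubits A B) (supp h)) ` Z_checks A B = stabilizer_generators A B"
    unfolding stabilizer_generators_def X_checks_def Z_checks_def x_check_def z_check_def by blast
  then show ?thesis by (simp add: stabilizer_group_def)
qed

lemma x_check_subset: "x_check A B r r' k \<subseteq> qubits A B"
  and z_check_subset: "z_check A B r r' k \<subseteq> qubits A B"
  by (simp_all add: x_check_def z_check_def supp_restrict_vec_subset)

lemma stabilizer_generators_unitary:
  "stabilizer_generators A B \<subseteq> carrier (unitary_group (qubits A B))"
  by (auto simp: stabilizer_generators_def pauli_X_unitary pauli_Z_unitary finite_qubits x_check_subset)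

lemma preserves_stabilizersI:
  assumes "U \<in> carrier (unitary_group (qubits A B))"
    and "\<And>k. k \<in> stabilizer_generators A B \<Longrightarrow> op_conj (qubits A B) U k \<in> stabilizer_group A B"
    and "\<And>k. k \<in> stabilizer_generators A B \<Longrightarrow> k \<in> op_conj (qubits A B) U ` stabilizer_group A B"
  shows "preserves_stabilizers A B U"
  unfolding preserves_stabilizers_def stabilizer_group_eq
  by (rule op_conj_generate)
    (use assms in \<open>simp_all add: finite_qubits stabilizer_generators_unitary stabilizer_group_eq\<close>)

text \<open>For the shift and Hadamard circuits, which permute the generators themselves. The phase
  circuit sends an X generator to a product and uses \<open>preserves_stabilizersI\<close>
  directly.\<close>

lemma preserves_stabilizers_permuteI:
  assumes U: "U \<in> carrier (unitary_group (qubits A B))"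
    and K: "op_conj (qubits A B) U ` stabilizer_generators A B = stabilizer_generators A B"
  shows "preserves_stabilizers A B U"
proof (rule preserves_stabilizersI[OF U])
  have gen: "stabilizer_generators A B \<subseteq> stabilizer_group A B"
    by (auto simp: stabilizer_group_eq generate.incl)
  fix k assume "k \<in> stabilizer_generators A B"
  then show "op_conj (qubits A B) U k \<in> stabilizer_group A B"
    "k \<in> op_conj (qubits A B) U ` stabilizer_group A B"
    using K gen by blast+
qed

text \<open>For images that hold exactly: the identity serves as the stabilizer.\<close>

lemma inducesI:
  assumes "op_conj (qubits A B) U P = P'" "P' \<in> carrier (unitary_group (qubits A B))"
  shows "induces A B U P P'"
  unfolding induces_def
proof (rule bexI)
  show "op_conj (qubits A B) U P = op_mult (qubits A B) P' (op_one (qubits A B))"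
    using assms by (simp add: unitary_op_mult_one finite_qubits)
  show "op_one (qubits A B) \<in> stabilizer_group A B"
    using generate.one[of "unitary_group (qubits A B)"] by (simp add: stabilizer_group_eq)
qed

text \<open>Each l by l block of a binarized matrix is circulant, depending only on
  \<open>k - m\<close> modulo l. Shifting rows and columns together therefore leaves it
  unchanged.\<close>

lemma bin_mat_eq_cyc:
  fixes H :: "'r \<Rightarrow> 'c \<Rightarrow> 'l::finite lring"
  shows "k < CARD('l) \<Longrightarrow> bin_mat H (r, k) (c, m) = lring_cyc (H r c) (int k - int m)"
  by (simp add: bin_mat_def lring_coeff_eq_cyc)

lemma bin_vec_eq_cyc:
  fixes v :: "'c \<Rightarrow> 'l::finite lring"
  shows "m < CARD('l) \<Longrightarrow> bin_vec v (c, m) = lring_cyc (v c) (int m)"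
  by (simp add: bin_vec_def lring_coeff_eq_cyc)

lemma lring_cyc_shift_diff:
  "lring_cyc (a :: 'l::finite lring) (int ((k + t) mod CARD('l)) - int ((m + t) mod CARD('l))) =
    lring_cyc a (int k - int m)"
  by (rule lring_cyc_cong) (simp only: zmod_int mod_diff_eq of_nat_add add_diff_cancel_right)

lemma shift_x_check:
  fixes A B :: "'l::finite lring mat"
  assumes "k < CARD('l)"
  shows "shift_qubit CARD('l) t ` x_check A B r r' k = x_check A B r r' ((k + t) mod CARD('l))"
  unfolding x_check_def
proof (rule image_supp_restrict_vec[OF bij_betw_shift_qubit])
  fix q
  show "bin_mat (H_X A B) ((r, r'), (k + t) mod CARD('l)) (shift_qubit CARD('l) t q) =
      bin_mat (H_X A B) ((r, r'), k) q"
    using assms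
    by (cases q) (auto simp: shift_qubit_def bin_mat_eq_cyc lring_cyc_shift_diff)
qed

lemma shift_z_check:
  fixes A B :: "'l::finite lring mat"
  assumes "k < CARD('l)"
  shows "shift_qubit CARD('l) t ` z_check A B r r' k = z_check A B r r' ((k + t) mod CARD('l))"
  unfolding z_check_def
proof (rule image_supp_restrict_vec[OF bij_betw_shift_qubit])
  fix q
  show "bin_mat (H_Z A B) ((r, r'), (k + t) mod CARD('l)) (shift_qubit CARD('l) t q) =
      bin_mat (H_Z A B) ((r, r'), k) q"
    using assms
    by (cases q) (auto simp: shift_qubit_def bin_mat_eq_cyc lring_cyc_shift_diff)
qed

section \<open>The action of the shift on logical operators and checks\<close>

definition z_support :: "'l::finite lring mat \<Rightarrow> 'l lring mat \<Rightarrow> 'l lring mat \<Rightarrow> nat \<Rightarrow> nat \<Rightarrow> nat \<Rightarrow> qubit set" where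
  "z_support A B GA i j m = supp (canonical_Z_vec A B GA i j m)"

definition x_support :: "'l::finite lring mat \<Rightarrow> 'l lring mat \<Rightarrow> 'l lring mat \<Rightarrow> nat \<Rightarrow> nat \<Rightarrow> nat \<Rightarrow> qubit set" where
  "x_support A B GB i j m = supp (canonical_X_vec A B GB i j m)"

lemma z_support_subset: "z_support A B GA i j m \<subseteq> qubits A B"
  and x_support_subset: "x_support A B GB i j m \<subseteq> qubits A B"
  by (simp_all add: z_support_def x_support_def canonical_Z_vec_def canonical_X_vec_def Let_def
      supp_restrict_vec_subset)

lemma shift_support:
  fixes A B :: "'l::finite lring mat"
  shows shift_z_support:
    "shift_qubit CARD('l) t ` z_support A B GA i j m = z_support A B GA i j ((m + t) mod CARD('l))"
    and shift_x_support:
    "shift_qubit CARD('l) t ` x_support A B GB i j m = x_support A B GB i j ((m + t) mod CARD('l))"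
proof -
  \<comment> \<open>Coefficient n of \<open>lring_X ^ m * v c\<close> depends only on n - m modulo
    l; leaving \<open>v\<close> arbitrary covers the Z and X supports at once.\<close>
  have "bin_vec (\<lambda>c. lring_X ^ ((m + t) mod CARD('l)) * v c) (shift_qubit CARD('l) t q) =
      bin_vec (\<lambda>c. lring_X ^ m * v c) q" if "q \<in> qubits A B" for v :: "position \<Rightarrow> 'l lring" and q
    using that
    by (elim qubits_cases)
      (auto simp: shift_qubit_def bin_vec_eq_cyc lring_cyc_shift_diff)
  then show
    "shift_qubit CARD('l) t ` z_support A B GA i j m = z_support A B GA i j ((m + t) mod CARD('l))"
    "shift_qubit CARD('l) t ` x_support A B GB i j m = x_support A B GB i j ((m + t) mod CARD('l))"
    unfolding z_support_def x_support_def canonical_Z_vec_def canonical_X_vec_def Let_def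
    by (intro image_supp_restrict_vec[OF bij_betw_shift_qubit]; blast)+
qed

lemma op_conj_shift:
  fixes A B :: "'l::finite lring mat"
  assumes "s \<subseteq> qubits A B"
  shows "op_conj (qubits A B) (perm_op (qubits A B) (shift_qubit CARD('l) t)) (pauli_X (qubits A B) s) =
      pauli_X (qubits A B) (shift_qubit CARD('l) t ` s)"
    and "op_conj (qubits A B) (perm_op (qubits A B) (shift_qubit CARD('l) t)) (pauli_Z (qubits A B) s) =
      pauli_Z (qubits A B) (shift_qubit CARD('l) t ` s)"
  using assms
  by (simp_all add: op_conj_perm_op_pauli_X op_conj_perm_op_pauli_Z finite_qubits bij_betw_shift_qubit)

lemma shift_preserves_stabilizers:
  fixes A B :: "'l::finite lring mat"
  shows "preserves_stabilizers A B (perm_op (qubits A B) (shift_qubit CARD('l) t))"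
proof (rule preserves_stabilizers_permuteI)
  show "perm_op (qubits A B) (shift_qubit CARD('l) t) \<in> carrier (unitary_group (qubits A B))"
    by (rule perm_op_unitary[OF finite_qubits bij_betw_shift_qubit])
  let ?C = "op_conj (qubits A B) (perm_op (qubits A B) (shift_qubit CARD('l) t))"
  have X: "?C (pauli_X (qubits A B) (x_check A B r r' k)) =
      pauli_X (qubits A B) (x_check A B r r' ((k + t) mod CARD('l)))" if "k < CARD('l)" for r r' k
    using that by (simp add: op_conj_shift x_check_subset shift_x_check)
  have Z: "?C (pauli_Z (qubits A B) (z_check A B r r' k)) =
      pauli_Z (qubits A B) (z_check A B r r' ((k + t) mod CARD('l)))" if "k < CARD('l)" for r r' k
    using that by (simp add: op_conj_shift z_check_subset shift_z_check)
  show "?C ` stabilizer_generators A B = stabilizer_generators A B"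
  proof (intro equalityI subsetI)
    fix P assume "P \<in> ?C ` stabilizer_generators A B"
    then obtain P' where "P = ?C P'" "P' \<in> stabilizer_generators A B"
      by (rule imageE)
    then show "P \<in> stabilizer_generators A B"
      by (elim stabilizer_generators_cases)
        (simp_all add: X Z pauli_X_mem_stabilizer_generators pauli_Z_mem_stabilizer_generators)
  next
    fix P assume "P \<in> stabilizer_generators A B"
    then show "P \<in> ?C ` stabilizer_generators A B"
    proof (cases rule: stabilizer_generators_cases)
      case (1 r r' k)
      \<comment> \<open>Shifting the row index back by t gives the generator that is mapped to
        \<open>P\<close>.\<close>
      let ?k = "(k + opposite_shift CARD('l) t) mod CARD('l)"
      have "P = ?C (pauli_X (qubits A B) (x_check A B r r' ?k))"
        using 1 by (simp add: X shift_mod_cancel)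
      then show ?thesis
        by (rule image_eqI[of _ ?C]) (use 1 in \<open>simp add: pauli_X_mem_stabilizer_generators\<close>)
    next
      case (2 r r' k)
      let ?k = "(k + opposite_shift CARD('l) t) mod CARD('l)"
      have "P = ?C (pauli_Z (qubits A B) (z_check A B r r' ?k))"
        using 2 by (simp add: Z shift_mod_cancel)
      then show ?thesis
        by (rule image_eqI[of _ ?C]) (use 2 in \<open>simp add: pauli_Z_mem_stabilizer_generators\<close>)
    qed
  qed
qed

lemma shift_induces:
  fixes A B :: "'l::finite lring mat"
  shows "induces A B (perm_op (qubits A B) (shift_qubit CARD('l) t))
      (logical_Z A B GA i j m) (logical_Z A B GA i j ((m + t) mod CARD('l)))"
    and "induces A B (perm_op (qubits A B) (shift_qubit CARD('l) t))
      (logical_X A B GB i j m) (logical_X A B GB i j ((m + t) mod CARD('l)))"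
  by (intro inducesI;
      simp add: logical_Z_def logical_X_def op_conj_shift pauli_X_unitary pauli_Z_unitary finite_qubits
        z_support_subset x_support_subset shift_z_support shift_x_support
        flip: z_support_def x_support_def)+

section \<open>Symmetric codes\<close>

lemma dim_star_mat [simp]: "dim_row (star_mat A) = dim_col A" "dim_col (star_mat A) = dim_row A"
  by (simp_all add: star_mat_def)

lemma index_star_mat: "i < dim_col A \<Longrightarrow> j < dim_row A \<Longrightarrow> star_mat A $$ (i, j) = lring_bar (A $$ (j, i))"
  by (simp add: star_mat_def)

lemma star_mat_star_mat [simp]: "star_mat (star_mat A) = A"
  by (rule eq_matI) (simp_all add: index_star_mat)

lemma r_B_star_mat: "r_B (star_mat A) = r_A A"
  by (simp add: r_A_def r_B_def)

lemma transpose_qubit_transpose_qubit [simp]: "transpose_qubit (transpose_qubit q) = q"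
  by (cases q rule: transpose_qubit.cases) simp_all

lemma transpose_qubit_in: "q \<in> qubits A (star_mat A) \<Longrightarrow> transpose_qubit q \<in> qubits A (star_mat A)"
  by (auto simp: mem_qubits elim!: qubits_cases)

lemma bij_betw_transpose_qubit: "bij_betw transpose_qubit (qubits A (star_mat A)) (qubits A (star_mat A))"
  by (rule bij_betw_byWitness[where f' = transpose_qubit]) (auto simp: transpose_qubit_in)

text \<open>For \<open>B = star_mat A\<close> the star of \<open>B\<close> is \<open>A\<close>
  again. The blocks of \<open>H_X\<close> are A \<otimes> I and I \<otimes> A*, those of
  \<open>H_Z\<close> are I \<otimes> A and A* \<otimes> I, so transposing positions swaps the tensor
  factors and matches the two matrices.\<close>

lemma transpose_x_check:
  fixes A :: "'l::finite lring mat"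
  assumes "r < dim_row A" "r' < dim_col A" "k < CARD('l)"
  shows "transpose_qubit ` x_check A (star_mat A) r r' k = z_check A (star_mat A) r' r k"
  unfolding x_check_def z_check_def
proof (rule image_supp_restrict_vec[OF bij_betw_transpose_qubit])
  fix q assume "q \<in> qubits A (star_mat A)"
  then show "bin_mat (H_Z A (star_mat A)) ((r', r), k) (transpose_qubit q) =
      bin_mat (H_X A (star_mat A)) ((r, r'), k) q"
    using assms
    by (elim qubits_cases)
      (auto simp: bin_mat_eq_cyc H_X_def H_Z_def kron_entry_def index_star_mat)
qed

lemma transpose_z_check:
  fixes A :: "'l::finite lring mat"
  assumes "r < dim_row A" "r' < dim_col A" "k < CARD('l)"
  shows "transpose_qubit ` z_check A (star_mat A) r' r k = x_check A (star_mat A) r r' k"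
  by (simp add: image_image flip: transpose_x_check[OF assms])

section \<open>Supports of the canonical logical operators of a symmetric code\<close>

lemma row_append_id:
  assumes "G \<in> carrier_mat r c" "i < r" "b < r + c"
  shows "row (append_id r G) i $ b = (if b < r then of_bool (i = b) else G $$ (i, b - r))"
  using assms by (auto simp: append_id_def)

context
  fixes A GA :: "'l::finite lring mat"
  assumes dims: "dim_row A \<le> dim_col A" and GA: "GA \<in> carrier_mat (r_A A) (dim_row A)"
begin

lemma r_A_dims: "r_A A + dim_row A = dim_col A"
  using dims by (simp add: r_A_def)

lemma row_append_id_GA:
  "i < r_A A \<Longrightarrow> b < dim_col A \<Longrightarrow>
    row (append_id (r_A A) GA) i $ b = (if b < r_A A then of_bool (i = b) else GA $$ (i, b - r_A A))"
  by (rule row_append_id[OF GA]) (simp_all add: r_A_dims)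

lemma row_append_id_zero:
  "i < r_A A \<Longrightarrow> b < dim_col A \<Longrightarrow>
    row (append_id (r_A A) (0\<^sub>m (r_A A) (dim_row A))) i $ b = (of_bool (i = b) :: 'l lring)"
  using r_A_dims by (subst row_append_id[where c = "dim_row A"]) auto

text \<open>With equal ranks and the same matrix \<open>GA\<close> on both sides, the vectors f and
  v of the canonical basis coincide with e and u. The supports are then u(i) \<otimes> e(j) and e(j)
  \<otimes> u(i).\<close>

lemma transpose_z_support:
  assumes "i < r_A A" "j < r_A A"
  shows "transpose_qubit ` z_support A (star_mat A) GA i j m = x_support A (star_mat A) GA j i m"
  unfolding z_support_def x_support_def canonical_Z_vec_def canonical_X_vec_def Let_def r_B_star_mat
proof (rule image_supp_restrict_vec[OF bij_betw_transpose_qubit])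
  fix q assume "q \<in> qubits A (star_mat A)"
  then show "bin_vec (\<lambda>c. lring_X ^ m * left_tensor (row (append_id (r_A A) (0\<^sub>m (r_A A) (dim_row A))) j)
        (row (append_id (r_A A) GA) i) c) (transpose_qubit q) =
      bin_vec (\<lambda>c. lring_X ^ m * left_tensor (row (append_id (r_A A) GA) i)
        (row (append_id (r_A A) (0\<^sub>m (r_A A) (dim_col (star_mat A)))) j) c) q"
    by (elim qubits_cases) (simp_all add: bin_vec_eq_cyc left_tensor_def mult.commute)
qed

lemma transpose_x_support:
  assumes "i < r_A A" "j < r_A A"
  shows "transpose_qubit ` x_support A (star_mat A) GA i j m = z_support A (star_mat A) GA j i m"
  by (simp add: image_image flip: transpose_z_support[OF assms(2,1)])

lemma q_R_notin_x_support: "q_R a b n \<notin> x_support A (star_mat A) GA i j m"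
  by (auto simp: x_support_def canonical_X_vec_def Let_def mem_supp_restrict_vec mem_qubits
      bin_vec_eq_cyc left_tensor_def)

lemma q_L_in_x_support:
  assumes "i < r_A A" "j < r_A A"
  shows "q_L a b n \<in> x_support A (star_mat A) GA i j m \<longleftrightarrow>
    q_L a b n \<in> qubits A (star_mat A) \<and> a = i \<and>
    lring_cyc (row (append_id (r_A A) GA) j $ b) (int n - int m) = 1"
  using assms
  by (cases "i = a") (auto simp: x_support_def canonical_X_vec_def Let_def mem_supp_restrict_vec mem_qubits
      bin_vec_eq_cyc left_tensor_def r_B_star_mat row_append_id_zero split: if_splits)

text \<open>The support lies in row \<open>i\<close> of the left block and meets the diagonal in
  column \<open>i\<close>. This column belongs to the identity part of \<open>append_id\<close>,
  where row \<open>j\<close> has entry 1 or 0; hence at most the single coefficient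
  \<open>m\<close>.\<close>

lemma x_support_diagonal_L:
  assumes ij: "i < r_A A" "j < r_A A" and m: "m < CARD('l)"
  shows "x_support A (star_mat A) GA i j m \<inter> diagonal_L A (star_mat A) = (if i = j then {q_L i i m} else {})"
proof -
  have i: "i < dim_col A" using ij r_A_dims by linarith
  \<comment> \<open>Both indices lie below l, so their difference is too small to be a nonzero
    multiple of l.\<close>
  have "int CARD('l) dvd int n - int m \<longleftrightarrow> n = m" if "n < CARD('l)" for n
  proof
    assume "int CARD('l) dvd int n - int m"
    then have "n \<noteq> m \<Longrightarrow> int CARD('l) \<le> \<bar>int n - int m\<bar>"
      using dvd_imp_le_int[of "int n - int m" "int CARD('l)"] by simp
    then show "n = m"
      using that m by linarith
  qed simp
  then show ?thesis
    using ij i m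
    by (auto simp: diagonal_L_def mem_qubits q_L_in_x_support row_append_id_GA lring_cyc_one)
qed

lemma x_support_diagonal_R: "x_support A (star_mat A) GA i j m \<inter> diagonal_R A (star_mat A) = {}"
  by (auto simp: diagonal_R_def q_R_notin_x_support)

text \<open>The support occupies a single row of the left block and avoids the right block; a
  position and its transpose share that row only on the diagonal. This gives isolation of the
  logical X supports.\<close>

lemma x_support_transpose_fixed:
  assumes "i < r_A A" "j < r_A A"
    and "q \<in> x_support A (star_mat A) GA i j m" "transpose_qubit q \<in> x_support A (star_mat A) GA i j m"
  shows "transpose_qubit q = q"
  using assms by (cases q rule: transpose_qubit.cases) (auto simp: q_L_in_x_support q_R_notin_x_support)

end

text \<open>The identity factors confine the check to column \<open>r'\<close> of the left block and
  row \<open>r\<close> of the right block, and each of these meets its transpose only on the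
  diagonal. This gives isolation of the X checks.\<close>

lemma x_check_transpose_fixed:
  fixes A :: "'l::finite lring mat"
  assumes "r < dim_row A" "r' < dim_col A" "k < CARD('l)"
    and "q \<in> x_check A (star_mat A) r r' k" "transpose_qubit q \<in> x_check A (star_mat A) r r' k"
  shows "transpose_qubit q = q"
proof -
  have L: "b = r'" if "q_L a b m \<in> x_check A (star_mat A) r r' k" for a b m
    using that assms(1-3)
    by (auto simp: x_check_def mem_supp_restrict_vec mem_qubits bin_mat_eq_cyc H_X_def kron_entry_def
        split: if_splits)
  have R: "a = r" if "q_R a b m \<in> x_check A (star_mat A) r r' k" for a b m
    using that assms(1-3)
    by (auto simp: x_check_def mem_supp_restrict_vec mem_qubits bin_mat_eq_cyc H_X_def kron_entry_def
        split: if_splits)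
  show ?thesis
    using assms(4,5) by (cases q rule: transpose_qubit.cases) (auto dest: L R)
qed

text \<open>
  The left diagonal meets the check in the coefficients of \<open>A $$ (r, r')\<close>, the right one in those
  of its conjugate; hence the phases \<open>\<i>\<close> and \<open>- \<i>\<close> cancel on every \<open>X\<close>-check.
\<close>

lemma card_x_check_diagonal:
  fixes A :: "'l::finite lring mat"
  assumes r: "r < dim_row A" "r' < dim_col A" and k: "k < CARD('l)"
  shows "card (x_check A (star_mat A) r r' k \<inter> diagonal_L A (star_mat A)) =
    card (x_check A (star_mat A) r r' k \<inter> diagonal_R A (star_mat A))"
proof -
  let ?a = "A $$ (r, r')" and ?l = "int CARD('l)"
  \<comment> \<open>The sign \<open>e\<close> is 1 for the entry itself and -1 for its conjugate,
    which reverses the coefficient index.\<close>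
  let ?M = "\<lambda>e. {m. m < CARD('l) \<and> lring_cyc ?a (e * (int k - int m)) = 1}"
  \<comment> \<open>Reflection of the coefficient index about \<open>k\<close> modulo l: it negates
    \<open>k - m\<close> and so exchanges the two sets.\<close>
  let ?f = "\<lambda>m. nat ((2 * int k - int m) mod ?l)"
  have L: "x_check A (star_mat A) r r' k \<inter> diagonal_L A (star_mat A) = q_L r' r' ` ?M 1"
    using r k
    by (auto simp: x_check_def mem_supp_restrict_vec mem_qubits bin_mat_eq_cyc H_X_def kron_entry_def
        diagonal_L_def split: if_splits)
  have R: "x_check A (star_mat A) r r' k \<inter> diagonal_R A (star_mat A) = q_R r r ` ?M (- 1)"
    using r k
    by (auto simp: x_check_def mem_supp_restrict_vec mem_qubits bin_mat_eq_cyc H_X_def kron_entry_def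
        diagonal_R_def index_star_mat split: if_splits)
  have f_less: "?f m < CARD('l)" for m
    by (simp add: nat_less_iff)
  have f_f: "?f (?f m) = m" if "m < CARD('l)" for m
    using that by (simp add: mod_diff_right_eq)
  have f_cyc: "lring_cyc ?a (e * (int k - int (?f m))) = lring_cyc ?a (- e * (int k - int m))" for e m
  proof (rule lring_cyc_cong)
    have "(e * (int k - int (?f m))) mod ?l = (e * ((int k - (2 * int k - int m) mod ?l) mod ?l)) mod ?l"
      by (simp add: mod_mult_right_eq)
    also have "\<dots> = (e * (int k - (2 * int k - int m))) mod ?l"
      by (simp only: mod_diff_right_eq mod_mult_right_eq)
    finally show "(e * (int k - int (?f m))) mod ?l = (- e * (int k - int m)) mod ?l"
      by (simp add: algebra_simps)
  qed
  have "bij_betw ?f (?M 1) (?M (- 1))"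
  proof (rule bij_betw_byWitness[where f' = ?f])
    show "?f ` ?M 1 \<subseteq> ?M (- 1)" "?f ` ?M (- 1) \<subseteq> ?M 1"
      using f_less f_cyc[of 1] f_cyc[of "- 1"] by auto
  qed (use f_f in auto)
  then have "card (?M 1) = card (?M (- 1))"
    by (rule bij_betw_same_card)
  then show ?thesis
    unfolding L R by (simp add: card_image inj_on_def)
qed

subsection \<open>Transversal Hadamard\<close>

lemma Hadamard_transpose:
  fixes A :: "'l::finite lring mat"
  defines "Q \<equiv> qubits A (star_mat A)"
  assumes gs: "distinct gs" "set gs = Hadamard ` Q"
  defines "U \<equiv> op_mult Q (perm_op Q transpose_qubit) (circuit_op Q gs)"
  shows Hadamard_transpose_unitary: "U \<in> carrier (unitary_group Q)"
    and op_conj_Hadamard_transpose: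
      "s \<subseteq> Q \<Longrightarrow> op_conj Q U (pauli_X Q s) = pauli_Z Q (transpose_qubit ` s)"
      "s \<subseteq> Q \<Longrightarrow> op_conj Q U (pauli_Z Q s) = pauli_X Q (transpose_qubit ` s)"
proof -
  have Q: "finite Q" unfolding Q_def by (rule finite_qubits)
  have bij: "bij_betw transpose_qubit Q Q" unfolding Q_def by (rule bij_betw_transpose_qubit)
  show "U \<in> carrier (unitary_group Q)"
    unfolding U_def by (intro op_mult_unitary[OF Q] perm_op_unitary[OF Q bij] circuit_op_Hadamard_unitary[OF Q gs])
  show "op_conj Q U (pauli_X Q s) = pauli_Z Q (transpose_qubit ` s)"
    "op_conj Q U (pauli_Z Q s) = pauli_X Q (transpose_qubit ` s)" if "s \<subseteq> Q"
    using that
    by (simp_all add: U_def op_conj_op_mult[OF Q] op_conj_Hadamard_pauli_X[OF Q gs]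
        op_conj_Hadamard_pauli_Z[OF Q gs] op_conj_perm_op_pauli_X[OF Q bij] op_conj_perm_op_pauli_Z[OF Q bij])
qed

lemma Hadamard_transpose_preserves_stabilizers:
  fixes A :: "'l::finite lring mat"
  defines "Q \<equiv> qubits A (star_mat A)"
  assumes gs: "distinct gs" "set gs = Hadamard ` Q"
  shows "preserves_stabilizers A (star_mat A) (op_mult Q (perm_op Q transpose_qubit) (circuit_op Q gs))"
    (is "preserves_stabilizers _ _ ?U")
proof -
  note gs' = gs[unfolded Q_def]
  have X: "op_conj Q ?U (pauli_X Q (x_check A (star_mat A) r r' k)) = pauli_Z Q (z_check A (star_mat A) r' r k)"
    and Z: "op_conj Q ?U (pauli_Z Q (z_check A (star_mat A) r' r k)) = pauli_X Q (x_check A (star_mat A) r r' k)"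
    if "r < dim_row A" "r' < dim_col A" "k < CARD('l)" for r r' k
    using that op_conj_Hadamard_transpose[OF gs'] unfolding Q_def
    by (simp_all add: x_check_subset z_check_subset transpose_x_check transpose_z_check)
  let ?C = "op_conj Q ?U"
  have mem: "pauli_X Q (x_check A (star_mat A) r r' k) \<in> stabilizer_generators A (star_mat A)"
    "pauli_Z Q (z_check A (star_mat A) r' r k) \<in> stabilizer_generators A (star_mat A)"
    if "r < dim_row A" "r' < dim_col A" "k < CARD('l)" for r r' k
    using that by (simp_all add: Q_def pauli_X_mem_stabilizer_generators pauli_Z_mem_stabilizer_generators)
  have "?C ` stabilizer_generators A (star_mat A) = stabilizer_generators A (star_mat A)"
  proof (intro equalityI subsetI)
    fix P assume "P \<in> ?C ` stabilizer_generators A (star_mat A)"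
    then obtain P' where "P = ?C P'" "P' \<in> stabilizer_generators A (star_mat A)"
      by (rule imageE)
    then show "P \<in> stabilizer_generators A (star_mat A)"
      by (elim stabilizer_generators_cases) (simp_all add: X Z mem flip: Q_def)
  next
    fix P assume "P \<in> stabilizer_generators A (star_mat A)"
    then show "P \<in> ?C ` stabilizer_generators A (star_mat A)"
    proof (cases rule: stabilizer_generators_cases)
      case (1 r r' k)
      \<comment> \<open>X and Z generators are exchanged in pairs, so the partner of
        \<open>P\<close> is its preimage.\<close>
      then have "P = ?C (pauli_Z Q (z_check A (star_mat A) r' r k))"
        by (simp add: Z flip: Q_def)
      then show ?thesis
        by (rule image_eqI[of _ ?C]) (use 1 in \<open>simp add: mem\<close>)
    next
      case (2 r' r k)
      then have "P = ?C (pauli_X Q (x_check A (star_mat A) r r' k))"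
        by (simp add: X flip: Q_def)
      then show ?thesis
        by (rule image_eqI[of _ ?C]) (use 2 in \<open>simp add: mem\<close>)
    qed
  qed
  then show ?thesis
    unfolding Q_def
    by (intro preserves_stabilizers_permuteI Hadamard_transpose_unitary[OF gs'])
qed

subsection \<open>Transversal phase gates\<close>

lemma op_scale_one [simp]: "op_scale 1 M = M"
  by (simp add: op_scale_def)

locale transpose_circuit =
  fixes A :: "'l::finite lring mat" and lt :: "qubit rel" and gs :: "qubit gate list"
  assumes lt: "strict_linear_order_on (qubits A (star_mat A)) lt" and distinct: "distinct gs"
    and set: "set gs = Phase ` diagonal_L A (star_mat A) \<union> PhaseDag ` diagonal_R A (star_mat A) \<union>
      {CZ q (transpose_qubit q) | q. q \<in> qubits A (star_mat A) \<and> (q, transpose_qubit q) \<in> lt}"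
begin

abbreviation "Q \<equiv> qubits A (star_mat A)"
abbreviation "U \<equiv> circuit_op Q gs"

sublocale involution_circuit Q transpose_qubit "diagonal_L A (star_mat A)" "diagonal_R A (star_mat A)" lt gs
proof (rule involution_circuit.intro)
  show "finite Q" by (rule finite_qubits)
  show "transpose_qubit q \<in> Q" if "q \<in> Q" for q using that by (rule transpose_qubit_in)
  show "transpose_qubit (transpose_qubit q) = q" for q by (rule transpose_qubit_transpose_qubit)
  show "diagonal_L A (star_mat A) \<union> diagonal_R A (star_mat A) = {q \<in> Q. transpose_qubit q = q}"
  proof (rule Set.set_eqI)
    fix q
    show "q \<in> diagonal_L A (star_mat A) \<union> diagonal_R A (star_mat A) \<longleftrightarrow> q \<in> {q \<in> Q. transpose_qubit q = q}"
      by (cases q rule: transpose_qubit.cases) (auto simp: diagonal_L_def diagonal_R_def)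
  qed
  show "diagonal_L A (star_mat A) \<inter> diagonal_R A (star_mat A) = {}"
    by (auto simp: diagonal_L_def diagonal_R_def)
qed (fact lt distinct set)+

text \<open>The check is isolated, and its equally many left and right diagonal qubits contribute
  inverse phases, so no scalar remains. The transposed check is a Z check.\<close>

lemma op_conj_x_check:
  assumes "r < dim_row A" "r' < dim_col A" "k < CARD('l)"
  shows "op_conj Q U (pauli_X Q (x_check A (star_mat A) r r' k)) =
    op_mult Q (pauli_X Q (x_check A (star_mat A) r r' k)) (pauli_Z Q (z_check A (star_mat A) r' r k))"
proof -
  have "isolated (x_check A (star_mat A) r r' k)"
    using x_check_transpose_fixed[OF assms] by (auto simp: isolated_def x_check_subset)
  moreover have "prod qubit_phase (x_check A (star_mat A) r r' k) = 1"
    unfolding prod_qubit_phase[OF x_check_subset] card_x_check_diagonal[OF assms]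
    by (simp flip: power_mult_distrib)
  ultimately show ?thesis
    by (simp add: op_conj_circuit_pauli_X transpose_x_check assms)
qed

lemma circuit_preserves_stabilizers: "preserves_stabilizers A (star_mat A) U"
proof (rule preserves_stabilizersI[OF circuit_unitary])
  let ?S = "stabilizer_group A (star_mat A)"
  have S: "P \<in> ?S" if "P \<in> stabilizer_generators A (star_mat A)" for P
    using that by (simp add: stabilizer_group_eq generate.incl)
  have S_mult: "op_mult Q P P' \<in> ?S" if "P \<in> ?S" "P' \<in> ?S" for P P'
    using that generate.eng[of P "unitary_group Q" _ P'] by (simp add: stabilizer_group_eq)
  fix P assume P: "P \<in> stabilizer_generators A (star_mat A)"
  then have "op_conj Q U P \<in> ?S \<and> P \<in> op_conj Q U ` ?S"
  proof (cases rule: stabilizer_generators_cases)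
    case (1 r r' k)
    let ?X = "pauli_X Q (x_check A (star_mat A) r r' k)"
    let ?Z = "pauli_Z Q (z_check A (star_mat A) r' r k)"
    have X: "?X \<in> ?S" and Z: "?Z \<in> ?S"
      using 1 by (simp_all add: S pauli_X_mem_stabilizer_generators pauli_Z_mem_stabilizer_generators)
    \<comment> \<open>A Z Pauli squares to the identity, so X is itself the image of the stabilizer
      XZ; this yields surjectivity on the X generators.\<close>
    have ZZ: "op_mult Q ?Z ?Z = op_one Q"
      by (simp add: pauli_Z_mono_op finite_Q op_mult_mono_op op_one_mono_op flip: power_mult_distrib)
    have "op_conj Q U (op_mult Q ?X ?Z) = op_mult Q (op_mult Q ?X ?Z) ?Z"
      using 1 by (simp add: op_conj_mult finite_Q circuit_unitary pauli_Z_unitary op_conj_circuit_pauli_Z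
          op_conj_x_check)
    also have "\<dots> = P"
      using 1(1) by (simp add: op_mult_assoc finite_Q ZZ unitary_op_mult_one pauli_X_unitary x_check_subset)
    finally have "P \<in> op_conj Q U ` ?S"
      using S_mult[OF X Z] by (metis image_eqI)
    then show ?thesis
      using 1 S_mult[OF X Z] by (simp add: op_conj_x_check)
  next
    case 2
    then have "op_conj Q U P = P"
      by (simp add: op_conj_circuit_pauli_Z)
    then show ?thesis
      using S[OF P] by (metis image_eqI)
  qed
  then show "op_conj Q U P \<in> ?S" "P \<in> op_conj Q U ` ?S" by blast+
qed

lemma circuit_induces_Z:
  "induces A (star_mat A) U (logical_Z A (star_mat A) GA i j m) (logical_Z A (star_mat A) GA i j m)"
  by (rule inducesI) (simp_all add: logical_Z_def op_conj_circuit_pauli_Z pauli_Z_unitary finite_Q)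

lemma op_conj_logical_X:
  assumes dims: "dim_row A \<le> dim_col A" "GA \<in> carrier_mat (r_A A) (dim_row A)"
    and ij: "i < r_A A" "j < r_A A" "m < CARD('l)"
  shows "op_conj Q U (logical_X A (star_mat A) GA i j m) =
    op_scale (if i = j then \<i> else 1)
      (op_mult Q (logical_X A (star_mat A) GA i j m) (logical_Z A (star_mat A) GA j i m))"
proof -
  let ?s = "x_support A (star_mat A) GA i j m"
  have "isolated ?s"
    using x_support_transpose_fixed[OF dims ij(1,2)] by (auto simp: isolated_def x_support_subset)
  moreover have "prod qubit_phase ?s = (if i = j then \<i> else 1)"
    by (simp add: prod_qubit_phase[OF x_support_subset] x_support_diagonal_L[OF dims ij]
        x_support_diagonal_R[OF dims])
  ultimately show ?thesis
    by (simp add: op_conj_circuit_pauli_X transpose_x_support[OF dims ij(1,2)] logical_X_def logical_Z_def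
        flip: x_support_def z_support_def)
qed

lemma circuit_induces_X:
  assumes dims: "dim_row A \<le> dim_col A" "GA \<in> carrier_mat (r_A A) (dim_row A)"
    and ij: "i < r_A A" "j < r_A A" "m < CARD('l)"
  shows "induces A (star_mat A) U (logical_X A (star_mat A) GA i j m)
    (op_scale (if i = j then \<i> else 1)
      (op_mult Q (logical_X A (star_mat A) GA i j m) (logical_Z A (star_mat A) GA j i m)))"
proof (rule inducesI[OF op_conj_logical_X[OF assms]])
  interpret group_hom "unitary_group Q" "unitary_group Q" "op_conj Q U"
    by (rule op_conj_hom[OF finite_Q circuit_unitary])
  have "logical_X A (star_mat A) GA i j m \<in> carrier (unitary_group Q)"
    by (simp add: logical_X_def pauli_X_unitary finite_Q x_support_subset flip: x_support_def)
  then show "op_scale (if i = j then \<i> else 1)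
      (op_mult Q (logical_X A (star_mat A) GA i j m) (logical_Z A (star_mat A) GA j i m))
      \<in> carrier (unitary_group Q)"
    \<comment> \<open>The stated image is the conjugate of a unitary by a unitary, so its unitarity
      follows from closure.\<close>
    unfolding op_conj_logical_X[OF assms, symmetric] by (rule hom_closed)
qed

end

section \<open>Logical action of the shift, Hadamard and phase circuits\<close>

theorem mainTheorem5:
  fixes A B GA GB :: "'l::finite lring mat" and lt :: "qubit rel"
  shows
    "(canonical_code_basis A B GA GB \<longrightarrow>
        (\<forall>t. let U = perm_op (qubits A B) (shift_qubit CARD('l) t) in
           preserves_stabilizers A B U \<and>
           (\<forall>i < r_A A. \<forall>j < r_B B. \<forall>m < CARD('l).
              induces A B U (logical_Z A B GA i j m) (logical_Z A B GA i j ((m + t) mod CARD('l))) \<and>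
              induces A B U (logical_X A B GB i j m) (logical_X A B GB i j ((m + t) mod CARD('l))))))
     \<and>
     (let B' = star_mat A; Q = qubits A B' in
        canonical_code_basis A B' GA GA \<longrightarrow>
          (\<forall>gs. distinct gs \<and> set gs = Hadamard ` Q \<longrightarrow>
             (let U = op_mult Q (perm_op Q transpose_qubit) (circuit_op Q gs) in
                depth_one gs \<and>
                preserves_stabilizers A B' U \<and>
                (\<forall>i < r_A A. \<forall>j < r_A A. \<forall>m < CARD('l).
                   induces A B' U (logical_Z A B' GA i j m) (logical_X A B' GA j i m) \<and>
                   induces A B' U (logical_X A B' GA i j m) (logical_Z A B' GA j i m))))
          \<and>
          (\<forall>gs. strict_linear_order_on Q lt \<and> distinct gs \<and>
             set gs = Phase ` diagonal_L A B' \<union> PhaseDag ` diagonal_R A B' \<union>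
               {CZ q (transpose_qubit q) | q. q \<in> Q \<and> (q, transpose_qubit q) \<in> lt} \<longrightarrow>
             (let U = circuit_op Q gs in
                depth_one gs \<and>
                preserves_stabilizers A B' U \<and>
                (\<forall>i < r_A A. \<forall>j < r_A A. \<forall>m < CARD('l).
                   induces A B' U (logical_Z A B' GA i j m) (logical_Z A B' GA i j m) \<and>
                   (i \<noteq> j \<longrightarrow>
                      induces A B' U (logical_X A B' GA i j m)
                        (op_mult Q (logical_X A B' GA i j m) (logical_Z A B' GA j i m))) \<and>
                   (i = j \<longrightarrow>
                      induces A B' U (logical_X A B' GA i i m) (logical_Y A B' GA GA i i m))))))"
proof (intro conjI impI allI)
  assume "canonical_code_basis A B GA GB"
  show "let U = perm_op (qubits A B) (shift_qubit CARD('l) t) in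
      preserves_stabilizers A B U \<and>
      (\<forall>i < r_A A. \<forall>j < r_B B. \<forall>m < CARD('l).
         induces A B U (logical_Z A B GA i j m) (logical_Z A B GA i j ((m + t) mod CARD('l))) \<and>
         induces A B U (logical_X A B GB i j m) (logical_X A B GB i j ((m + t) mod CARD('l))))" for t
    unfolding Let_def using shift_preserves_stabilizers shift_induces by blast
next
  let ?B = "star_mat A"
  let ?Q = "qubits A ?B"
  show "let B' = ?B; Q = qubits A B' in
        canonical_code_basis A B' GA GA \<longrightarrow>
          (\<forall>gs. distinct gs \<and> set gs = Hadamard ` Q \<longrightarrow>
             (let U = op_mult Q (perm_op Q transpose_qubit) (circuit_op Q gs) in
                depth_one gs \<and>
                preserves_stabilizers A B' U \<and>
                (\<forall>i < r_A A. \<forall>j < r_A A. \<forall>m < CARD('l).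
                   induces A B' U (logical_Z A B' GA i j m) (logical_X A B' GA j i m) \<and>
                   induces A B' U (logical_X A B' GA i j m) (logical_Z A B' GA j i m))))
          \<and>
          (\<forall>gs. strict_linear_order_on Q lt \<and> distinct gs \<and>
             set gs = Phase ` diagonal_L A B' \<union> PhaseDag ` diagonal_R A B' \<union>
               {CZ q (transpose_qubit q) | q. q \<in> Q \<and> (q, transpose_qubit q) \<in> lt} \<longrightarrow>
             (let U = circuit_op Q gs in
                depth_one gs \<and>
                preserves_stabilizers A B' U \<and>
                (\<forall>i < r_A A. \<forall>j < r_A A. \<forall>m < CARD('l).
                   induces A B' U (logical_Z A B' GA i j m) (logical_Z A B' GA i j m) \<and>
                   (i \<noteq> j \<longrightarrow>
                      induces A B' U (logical_X A B' GA i j m)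
                        (op_mult Q (logical_X A B' GA i j m) (logical_Z A B' GA j i m))) \<and>
                   (i = j \<longrightarrow>
                      induces A B' U (logical_X A B' GA i i m) (logical_Y A B' GA GA i i m)))))"
    unfolding Let_def
  proof (intro impI conjI allI; (elim conjE)?)
    assume "canonical_code_basis A ?B GA GA"
    then have dims: "dim_row A \<le> dim_col A" "GA \<in> carrier_mat (r_A A) (dim_row A)"
      by (simp_all add: canonical_code_basis_def)
    {
      fix gs assume gs: "distinct gs" "set gs = Hadamard ` ?Q"
      let ?U = "op_mult ?Q (perm_op ?Q transpose_qubit) (circuit_op ?Q gs)"
      show "depth_one gs"
        unfolding depth_one_iff[OF gs(1)] gs(2) by auto
      show "preserves_stabilizers A ?B ?U"
        by (rule Hadamard_transpose_preserves_stabilizers[OF gs])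
      fix i j m assume ij: "i < r_A A" "j < r_A A"
      show "induces A ?B ?U (logical_Z A ?B GA i j m) (logical_X A ?B GA j i m)"
        "induces A ?B ?U (logical_X A ?B GA i j m) (logical_Z A ?B GA j i m)"
        by (intro inducesI;
            simp add: logical_X_def logical_Z_def op_conj_Hadamard_transpose[OF gs] z_support_subset
              x_support_subset transpose_z_support[OF dims ij] transpose_x_support[OF dims ij]
              pauli_X_unitary pauli_Z_unitary finite_qubits
              flip: z_support_def x_support_def)+
    next
      fix gs
      assume "strict_linear_order_on ?Q lt" "distinct gs"
        and "set gs = Phase ` diagonal_L A ?B \<union> PhaseDag ` diagonal_R A ?B \<union>
          {CZ q (transpose_qubit q) | q. q \<in> ?Q \<and> (q, transpose_qubit q) \<in> lt}"
      then interpret transpose_circuit A lt gs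
        by unfold_locales
      show "depth_one gs" by (rule depth_one_gs)
      show "preserves_stabilizers A ?B (circuit_op ?Q gs)" by (rule circuit_preserves_stabilizers)
      fix i j m assume ij: "i < r_A A" "j < r_A A" "m < CARD('l)"
      show "induces A ?B (circuit_op ?Q gs) (logical_Z A ?B GA i j m) (logical_Z A ?B GA i j m)"
        by (rule circuit_induces_Z)
      show "induces A ?B (circuit_op ?Q gs) (logical_X A ?B GA i j m)
          (op_mult ?Q (logical_X A ?B GA i j m) (logical_Z A ?B GA j i m))" if "i \<noteq> j"
        using circuit_induces_X[OF dims ij] that by simp
      \<comment> \<open>For equal indices the support has exactly one diagonal qubit, on the left;
        its phase \<i> is the scalar in \<open>logical_Y\<close>.\<close>
      show "induces A ?B (circuit_op ?Q gs) (logical_X A ?B GA i i m) (logical_Y A ?B GA GA i i m)"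
        using circuit_induces_X[OF dims ij(1,1,3)] by (simp add: logical_Y_def)
    }
  qed
qed

end
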